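(* Let $\delta\in(0,1]$ be the constant described in the context, let $\eta,\omega\in W^{1,\infty}(\mathbb R;\mathbb R^3)\cap C^1(\mathbb R;\mathbb R^3)$ with $\|(\eta,\omega)\|_{W^{1,\infty}}\le\delta$, and let $u(t)$ be the corresponding solution described in the context. If in addition $\eta$ and $\omega$ are $l$-periodic with some period $l>0$, then $u(t)$ is periodic with the same period $l$. For given $R>2$, the associated pressure $p(t)$ singled out by $\int_{D_R}p(t)\,dx=0$ is also $l$-periodic.
   Context: Domain and spaces. $D\subset\mathbb R^3$ is a fixed exterior domain with $C^{1,1}$ boundary; $\mathbb R^3\setminus D$ is compact with nonempty interior and contained in $B_1$, where $B_\rho$ is the open ball of radius $\rho$ centered at $0$. $D_R=D\cap B_R$. $\|\cdot\|_q$ and $\|\cdot\|_{q,r}$ are the norms of $L^q(D)$ and of the Lorentz space $L^{q,r}(D)$. $W^{-1,r}(D_R)=W^{1,r'}_0(D_R)^*$. $C_{0,\sigma}^\infty(D)$ is the set of divergence-free fields in $C_0^\infty(D)$, $L^q_\sigma(D)$ ($1<q<\infty$) its closure in $L^q(D)$, $P$ the Fujita-Kato (Helmholtz) projection of $L^q(D)$ onto $L^q_\sigma(D)$ along gradients, extended to Lorentz spaces by interpolation, and $L^{q,r}_\sigma(D):=P(L^{q,r}(D))$; $L^{3,\infty}_\sigma(D)=L^{3/2,1}_\sigma(D)^*$. $BC_{w^*}$, $BC$, $BC_w$ denote bounded functions that are weak*-, strongly, weakly continuous, respectively. $C^1_w(\mathbb R;X)$ ($X$ reflexive) is the set of weakly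 continuous $u$ with $\langle u(\cdot),\psi\rangle\in C^1(\mathbb R)$ for all $\psi\in X^*$ and $|\frac{d}{dt}\langle u(t),\psi\rangle|\le c(t)\|\psi\|_{X^*}$; $\partial_tu(t)\in X$ is then defined by $\langle\partial_tu(t),\psi\rangle=\frac{d}{dt}\langle u(t),\psi\rangle$. Tensor conventions: $(u\otimes v)_{ij}=u_iv_j$, $(\mathrm{div}\,F)_i=\sum_j\partial_jF_{ij}$, $(\nabla\psi)_{ij}=\partial_j\psi_i$. Evolution operator. $\|(\eta,\omega)\|_{W^{1,\infty}}$ is the $W^{1,\infty}(\mathbb R)$ norm of $(\eta,\omega)$. For $t\in\mathbb R$, $L_+(t)u=-P[\Delta u+(\eta(t)+\omega(t)\times x)\cdot\nabla u-\omega(t)\times u]$ with domain $\{u\in L^q_\sigma(D)\cap W_0^{1,q}(D)\cap W^{2,q}(D):(\omega(t)\times x)\cdot\nabla u\in L^q(D)\}$. $\{T(t,s)\}_{-\infty<s\le t<\infty}$ is the evolution operator on $L^q_\sigma(D)$ ($1<q<\infty$) generated by $\{L_+(t)\}$ (Hansel-Rhandi), i.e. the solution operator $u(s)=g\mapsto u(t)$ of $\frac{du}{dt}+L_+(t)u=0$, $u(s)=g$. The composite $T(t,s)P\,\mathrm{div}$ extends (by duality) to a bounded operator from $L^q(D)^{3\times3}$ to $L^r_\sigma(D)$ for $3/2\le q\le r<\infty$, and to $L^\infty(D)$. Lift and force. Fix $\varphi\in C_0^\infty(B_2)$ with $\varphi=1$ on $B_1$ and set $b(x,t)=\frac12\mathrm{rot}[\varphi(x)(\eta(t)\times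 x-|x|^2\omega(t))]$ and $f=\Delta b+(\eta+\omega\times x)\cdot\nabla b-\omega\times b-\partial_tb-b\cdot\nabla b$. The solution $u$, the constant $\delta$, the pressure. There is a constant $\delta\in(0,1]$ such that, whenever $\|(\eta,\omega)\|_{W^{1,\infty}}\le\delta$, the integral equation $$u(t)=\int_{-\infty}^tT(t,s)Pf(s)\,ds-\int_{-\infty}^tT(t,s)P\,\mathrm{div}(u\otimes u+u\otimes b+b\otimes u)(s)\,ds\qquad(t\in\mathbb R)$$ (Bochner integrals, equality in $L^q_\sigma(D)$) has a unique solution $u$ with $u\in BC_{w^*}(\mathbb R;L^{3,\infty}_\sigma(D))$ and $\sup_t\|u(t)\|_{3,\infty}\le C(D)\|(\eta,\omega)\|_{W^{1,\infty}}$; moreover $u\in BC(\mathbb R;L^q_\sigma(D))\cap BC_w(\mathbb R;W^{1,q}_0(D))$ with $\sup_t(\|u(t)\|_q+\|\nabla u(t)\|_q)\le C(q,D)\|(\eta,\omega)\|_{W^{1,\infty}}$ for all $q\in(3,\infty)$, and, for every $R>2$ and $r\in(1,\infty)$, $u\in C^1_w(\mathbb R;W^{-1,r}(D_R))$ and there is an associated pressure $p\in BC_w(\mathbb R;L^r(D_R))$, i.e. a function $p(t)$ on $D$ such that for each $t$ and all $\psi\in C_0^\infty(D)^3$ $$\langle\partial_tu,\psi\rangle+\langle\nabla u+u\otimes(\eta+\omega\times x),\nabla\psi\rangle+\langle\omega\times u,\psi\rangle-\langle p,\mathrm{div}\,\psi\rangle=\langle u\otimes u+u\otimes b+b\otimes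 u,\nabla\psi\rangle+\langle f,\psi\rangle,$$ made unique by $\int_{D_R}p(t)\,dx=0$. *)

theory Defs
  imports "HOL-Analysis.Analysis"
begin

text \<open>
  Elements of function spaces over an open set \<open>\<Omega>\<close> are represented by functions on the whole of
  \<open>\<real>\<^sup>3\<close>; their values outside \<open>\<Omega>\<close> are irrelevant and equality in the space is equality almost
  everywhere on \<open>\<Omega>\<close>.  Objects determined only up to null sets (weak derivatives, Helmholtz
  projection, evolution operator) are accessed through a representative chosen by \<open>SOME\<close>.
\<close>

type_synonym vec3 = "real^3"
type_synonym scalar_field = "vec3 \<Rightarrow> real"
type_synonym vector_field = "vec3 \<Rightarrow> vec3"
type_synonym tensor_field = "vec3 \<Rightarrow> real^3^3"

section \<open>Classical vector calculus\<close>

definition partial :: "3 \<Rightarrow> (vec3 \<Rightarrow> 'b::real_normed_vector) \<Rightarrow> vec3 \<Rightarrow> 'b" where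
  "partial j f x = vector_derivative (\<lambda>h. f (x + h *\<^sub>R axis j 1)) (at 0)"

primrec Ck :: "nat \<Rightarrow> (vec3 \<Rightarrow> 'b::real_normed_vector) \<Rightarrow> bool" where
  "Ck 0 f \<longleftrightarrow> continuous_on UNIV f"
| "Ck (Suc k) f \<longleftrightarrow> (\<forall>x. f differentiable (at x)) \<and> (\<forall>j. Ck k (partial j f))"

definition test_functions :: "vec3 set \<Rightarrow> (vec3 \<Rightarrow> 'b::real_normed_vector) set" where
  "test_functions \<Omega> =
     {f. (\<forall>k. Ck k f) \<and> compact (closure {x. f x \<noteq> 0}) \<and> closure {x. f x \<noteq> 0} \<subseteq> \<Omega>}"

definition divg :: "vector_field \<Rightarrow> scalar_field" where
  "divg v x = (\<Sum>j\<in>UNIV. partial j v x $ j)"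

definition rot :: "vector_field \<Rightarrow> vector_field" where
  "rot v x = vector [partial 2 v x $ 3 - partial 3 v x $ 2,
                     partial 3 v x $ 1 - partial 1 v x $ 3,
                     partial 1 v x $ 2 - partial 2 v x $ 1]"

definition laplace :: "vector_field \<Rightarrow> vector_field" where
  "laplace v x = (\<Sum>j\<in>UNIV. partial j (partial j v) x)"

definition grad :: "vector_field \<Rightarrow> tensor_field" where
  "grad v x = (\<chi> i j. partial j v x $ i)"

definition div_tensor :: "tensor_field \<Rightarrow> vector_field" where
  "div_tensor F x = (\<chi> i. \<Sum>j\<in>UNIV. partial j F x $ i $ j)"

definition advect :: "vec3 \<Rightarrow> vector_field \<Rightarrow> vector_field" where
  "advect a v x = (\<Sum>j\<in>UNIV. (a $ j) *\<^sub>R partial j v x)"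

definition tensor :: "vec3 \<Rightarrow> vec3 \<Rightarrow> real^3^3"  (infixl "\<otimes>\<^sub>t" 70) where
  "a \<otimes>\<^sub>t b = (\<chi> i j. a $ i * b $ j)"

section \<open>Lebesgue and Lorentz spaces\<close>

definition Lp :: "real \<Rightarrow> vec3 set \<Rightarrow> (vec3 \<Rightarrow> 'b::euclidean_space) set" where
  "Lp q \<Omega> = {f. f \<in> borel_measurable (lebesgue_on \<Omega>) \<and>
                 integrable (lebesgue_on \<Omega>) (\<lambda>x. norm (f x) powr q)}"

definition Lp_norm :: "real \<Rightarrow> vec3 set \<Rightarrow> (vec3 \<Rightarrow> 'b::euclidean_space) \<Rightarrow> real" where
  "Lp_norm q \<Omega> f = (LINT x|lebesgue_on \<Omega>. norm (f x) powr q) powr (1 / q)"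

definition Lp_tendsto ::
  "real \<Rightarrow> vec3 set \<Rightarrow> ('i \<Rightarrow> vec3 \<Rightarrow> 'b::euclidean_space) \<Rightarrow> (vec3 \<Rightarrow> 'b) \<Rightarrow> 'i filter \<Rightarrow> bool" where
  "Lp_tendsto q \<Omega> f g \<F> \<longleftrightarrow> g \<in> Lp q \<Omega> \<and> (\<forall>\<^sub>F i in \<F>. f i \<in> Lp q \<Omega>) \<and>
     ((\<lambda>i. Lp_norm q \<Omega> (\<lambda>x. f i x - g x)) \<longlongrightarrow> 0) \<F>"

definition loc_integrable :: "vec3 set \<Rightarrow> (vec3 \<Rightarrow> 'b::euclidean_space) \<Rightarrow> bool" where
  "loc_integrable \<Omega> f \<longleftrightarrow> (\<forall>K. compact K \<and> K \<subseteq> \<Omega> \<longrightarrow> integrable (lebesgue_on K) f)"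

definition distribution :: "vec3 set \<Rightarrow> (vec3 \<Rightarrow> 'b::euclidean_space) \<Rightarrow> real \<Rightarrow> real" where
  "distribution \<Omega> f \<sigma> = measure (lebesgue_on \<Omega>) {x\<in>\<Omega>. \<sigma> < norm (f x)}"

text \<open>
  The Lorentz quasi-norms are expressed by the distribution function:
  \<open>\<parallel>f\<parallel>\<^sub>q\<^sub>,\<^sub>\<infinity> = sup\<^sub>\<sigma> \<sigma> |{|f| > \<sigma>}|\<^bsup>1/q\<^esup>\<close> and
  \<open>\<parallel>f\<parallel>\<^sub>q\<^sub>,\<^sub>r\<^sup>r = q \<integral>\<^sub>0\<^sup>\<infinity> (\<sigma> |{|f| > \<sigma>}|\<^bsup>1/q\<^esup>)\<^sup>r d\<sigma>/\<sigma>\<close>; these coincide with the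
  quasi-norms defined by the decreasing rearrangement.
\<close>

definition Lorentz :: "real \<Rightarrow> ennreal \<Rightarrow> vec3 set \<Rightarrow> (vec3 \<Rightarrow> 'b::euclidean_space) set" where
  "Lorentz q r \<Omega> = {f. f \<in> borel_measurable (lebesgue_on \<Omega>) \<and>
     (\<forall>\<sigma>>0. emeasure (lebesgue_on \<Omega>) {x\<in>\<Omega>. \<sigma> < norm (f x)} < \<infinity>) \<and>
     (if r = \<infinity> then bdd_above ((\<lambda>\<sigma>. \<sigma> * distribution \<Omega> f \<sigma> powr (1 / q)) ` {0<..})
      else integrable (lebesgue_on {0<..})
             (\<lambda>\<sigma>. (\<sigma> * distribution \<Omega> f \<sigma> powr (1 / q)) powr enn2real r / \<sigma>))}"

definition Lorentz_norm :: "real \<Rightarrow> ennreal \<Rightarrow> vec3 set \<Rightarrow> (vec3 \<Rightarrow> 'b::euclidean_space) \<Rightarrow> real" where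
  "Lorentz_norm q r \<Omega> f =
     (if r = \<infinity> then SUP \<sigma>\<in>{0<..}. \<sigma> * distribution \<Omega> f \<sigma> powr (1 / q)
      else (q * (LINT \<sigma>|lebesgue_on {0<..}.
             (\<sigma> * distribution \<Omega> f \<sigma> powr (1 / q)) powr enn2real r / \<sigma>)) powr (1 / enn2real r))"

section \<open>Sobolev spaces\<close>

definition weak_partial ::
  "vec3 set \<Rightarrow> 3 \<Rightarrow> (vec3 \<Rightarrow> 'b::euclidean_space) \<Rightarrow> (vec3 \<Rightarrow> 'b) \<Rightarrow> bool" where
  "weak_partial \<Omega> j f g \<longleftrightarrow> loc_integrable \<Omega> f \<and> loc_integrable \<Omega> g \<and>
     (\<forall>\<psi>\<in>test_functions \<Omega>.
        (LINT x|lebesgue_on \<Omega>. partial j \<psi> x *\<^sub>R f x) = - (LINT x|lebesgue_on \<Omega>. \<psi> x *\<^sub>R g x))"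

definition wpartial :: "vec3 set \<Rightarrow> 3 \<Rightarrow> (vec3 \<Rightarrow> 'b::euclidean_space) \<Rightarrow> vec3 \<Rightarrow> 'b" where
  "wpartial \<Omega> j f = (SOME g. weak_partial \<Omega> j f g)"

definition wgrad :: "vec3 set \<Rightarrow> vector_field \<Rightarrow> tensor_field" where
  "wgrad \<Omega> u x = (\<chi> i j. wpartial \<Omega> j u x $ i)"

definition W1 :: "real \<Rightarrow> vec3 set \<Rightarrow> vector_field set" where
  "W1 q \<Omega> = {u \<in> Lp q \<Omega>. \<forall>j. \<exists>g\<in>Lp q \<Omega>. weak_partial \<Omega> j u g}"

definition W1_norm :: "real \<Rightarrow> vec3 set \<Rightarrow> vector_field \<Rightarrow> real" where
  "W1_norm q \<Omega> u = Lp_norm q \<Omega> u + Lp_norm q \<Omega> (wgrad \<Omega> u)"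

definition W10 :: "real \<Rightarrow> vec3 set \<Rightarrow> vector_field set" where
  "W10 q \<Omega> = {u \<in> W1 q \<Omega>. \<exists>\<phi>. (\<forall>n. \<phi> n \<in> test_functions \<Omega>) \<and>
                 (\<lambda>n::nat. W1_norm q \<Omega> (\<lambda>x. \<phi> n x - u x)) \<longlonglongrightarrow> 0}"

definition W2 :: "real \<Rightarrow> vec3 set \<Rightarrow> vector_field set" where
  "W2 q \<Omega> = {u \<in> W1 q \<Omega>. \<forall>j. wpartial \<Omega> j u \<in> W1 q \<Omega>}"

section \<open>Dual spaces and weak continuity\<close>

text \<open>
  A normed space is given by a carrier \<open>X\<close> of functions and a (semi)norm \<open>N\<close>.  The type is general
  enough for \<open>X\<close> to be a space of fields or itself a dual space.
\<close>

definition dual_space ::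
  "('a \<Rightarrow> 'b::real_vector) set \<Rightarrow> (('a \<Rightarrow> 'b) \<Rightarrow> real) \<Rightarrow> (('a \<Rightarrow> 'b) \<Rightarrow> real) set" where
  "dual_space X N = {F.
     (\<forall>f\<in>X. \<forall>g\<in>X. F (\<lambda>x. f x + g x) = F f + F g) \<and>
     (\<forall>c. \<forall>f\<in>X. F (\<lambda>x. c *\<^sub>R f x) = c * F f) \<and>
     (\<exists>K. \<forall>f\<in>X. \<bar>F f\<bar> \<le> K * N f)}"

definition dual_norm ::
  "('a \<Rightarrow> 'b::real_vector) set \<Rightarrow> (('a \<Rightarrow> 'b) \<Rightarrow> real) \<Rightarrow> (('a \<Rightarrow> 'b) \<Rightarrow> real) \<Rightarrow> real" where
  "dual_norm X N F = (SUP f\<in>{f\<in>X. N f \<le> 1}. \<bar>F f\<bar>)"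

definition BC_weak ::
  "('a \<Rightarrow> 'b::real_vector) set \<Rightarrow> (('a \<Rightarrow> 'b) \<Rightarrow> real) \<Rightarrow> (real \<Rightarrow> 'a \<Rightarrow> 'b) \<Rightarrow> bool" where
  "BC_weak X N u \<longleftrightarrow> (\<forall>t. u t \<in> X) \<and> bdd_above (range (\<lambda>t. N (u t))) \<and>
     (\<forall>\<psi>\<in>dual_space X N. continuous_on UNIV (\<lambda>t. \<psi> (u t)))"

definition C1_weak ::
  "('a \<Rightarrow> 'b::real_vector) set \<Rightarrow> (('a \<Rightarrow> 'b) \<Rightarrow> real) \<Rightarrow> (real \<Rightarrow> 'a \<Rightarrow> 'b) \<Rightarrow> bool" where
  "C1_weak X N u \<longleftrightarrow> (\<forall>t. u t \<in> X) \<and>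
     (\<forall>\<psi>\<in>dual_space X N. continuous_on UNIV (\<lambda>t. \<psi> (u t)) \<and>
                         (\<lambda>t. \<psi> (u t)) C1_differentiable_on UNIV) \<and>
     (\<exists>c. \<forall>t. \<forall>\<psi>\<in>dual_space X N. \<bar>deriv (\<lambda>\<tau>. \<psi> (u \<tau>)) t\<bar> \<le> c t * dual_norm X N \<psi>)"

definition Wneg :: "real \<Rightarrow> vec3 set \<Rightarrow> (vector_field \<Rightarrow> real) set" where
  "Wneg r \<Omega> = (let r' = r / (r - 1) in dual_space (W10 r' \<Omega>) (W1_norm r' \<Omega>))"

definition Wneg_norm :: "real \<Rightarrow> vec3 set \<Rightarrow> (vector_field \<Rightarrow> real) \<Rightarrow> real" where
  "Wneg_norm r \<Omega> = (let r' = r / (r - 1) in dual_norm (W10 r' \<Omega>) (W1_norm r' \<Omega>))"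

definition pairing :: "vec3 set \<Rightarrow> (vec3 \<Rightarrow> 'b::euclidean_space) \<Rightarrow> (vec3 \<Rightarrow> 'b) \<Rightarrow> real" where
  "pairing \<Omega> u v = (LINT x|lebesgue_on \<Omega>. u x \<bullet> v x)"

section \<open>Exterior domains\<close>

text \<open>
  Near each boundary point, in a suitable orthonormal coordinate system centred there, the set is
  the part above the graph of a function with Lipschitz continuous gradient.
\<close>

definition C11_boundary :: "vec3 set \<Rightarrow> bool" where
  "C11_boundary D \<longleftrightarrow> (\<forall>x0\<in>frontier D. \<exists>Q::vec3 \<Rightarrow> vec3. \<exists>e>0. \<exists>(\<gamma>::real^2 \<Rightarrow> real) G L.
     orthogonal_transformation Q \<and>
     (\<forall>z. (\<gamma> has_derivative (\<lambda>h. G z \<bullet> h)) (at z)) \<and> L-lipschitz_on UNIV G \<and>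
     (\<forall>y\<in>ball x0 e. y \<in> D \<longleftrightarrow>
        \<gamma> (vector [Q (y - x0) $ 1, Q (y - x0) $ 2]) < Q (y - x0) $ 3))"

definition exterior_domain :: "vec3 set \<Rightarrow> bool" where
  "exterior_domain D \<longleftrightarrow> open D \<and> connected D \<and> C11_boundary D \<and>
     compact (- D) \<and> interior (- D) \<noteq> {} \<and> - D \<subseteq> ball 0 1"

definition trunc :: "vec3 set \<Rightarrow> real \<Rightarrow> vec3 set" where
  "trunc D R = D \<inter> ball 0 R"

section \<open>Solenoidal fields and the Helmholtz projection\<close>

definition test_sigma :: "vec3 set \<Rightarrow> vector_field set" where
  "test_sigma D = {v \<in> test_functions D. \<forall>x. divg v x = 0}"

definition Lp_sigma :: "real \<Rightarrow> vec3 set \<Rightarrow> vector_field set" where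
  "Lp_sigma q D = {v. \<exists>V. (\<forall>n. V n \<in> test_sigma D) \<and> Lp_tendsto q D V v sequentially}"

text \<open>The gradients are those of \<open>\<pi> \<in> L\<^sup>q\<^sub>l\<^sub>o\<^sub>c\<close> up to the boundary with \<open>\<nabla>\<pi> \<in> L\<^sup>q(D)\<close>.\<close>

definition gradient_fields :: "real \<Rightarrow> vec3 set \<Rightarrow> vector_field set" where
  "gradient_fields q D = {g \<in> Lp q D. \<exists>\<pi>::scalar_field.
     (\<forall>R. \<pi> \<in> Lp q (trunc D R)) \<and> (\<forall>j. weak_partial D j \<pi> (\<lambda>x. g x $ j))}"

definition helmholtz :: "real \<Rightarrow> vec3 set \<Rightarrow> vector_field \<Rightarrow> vector_field" where
  "helmholtz q D f = (SOME v. v \<in> Lp_sigma q D \<and> (\<lambda>x. f x - v x) \<in> gradient_fields q D)"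

text \<open>
  \<open>L\<^sup>q\<^sup>,\<^sup>r\<close> lies between \<open>L\<^bsup>q1\<^esup>\<close> and \<open>L\<^bsup>q2\<^esup>\<close> for \<open>q1 < q < q2\<close>; the interpolated projection is
  the restriction of the projection on \<open>L\<^bsup>q1\<^esup> + L\<^bsup>q2\<^esup>\<close>.
\<close>

definition Lorentz_sigma :: "real \<Rightarrow> ennreal \<Rightarrow> vec3 set \<Rightarrow> vector_field set" where
  "Lorentz_sigma q r D = {v. \<exists>q1 q2 f1 f2. 1 < q1 \<and> q1 < q \<and> q < q2 \<and>
     f1 \<in> Lp q1 D \<and> f2 \<in> Lp q2 D \<and> (\<lambda>x. f1 x + f2 x) \<in> Lorentz q r D \<and>
     (AE x in lebesgue_on D. v x = helmholtz q1 D f1 x + helmholtz q2 D f2 x)}"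

section \<open>The evolution operator\<close>

definition wlaplace :: "vec3 set \<Rightarrow> vector_field \<Rightarrow> vector_field" where
  "wlaplace \<Omega> u x = (\<Sum>j\<in>UNIV. wpartial \<Omega> j (wpartial \<Omega> j u) x)"

definition wadvect :: "vec3 set \<Rightarrow> vec3 \<Rightarrow> vector_field \<Rightarrow> vec3 \<Rightarrow> vec3" where
  "wadvect \<Omega> a u x = (\<Sum>j\<in>UNIV. (a $ j) *\<^sub>R wpartial \<Omega> j u x)"

definition dom_Lplus :: "real \<Rightarrow> vec3 set \<Rightarrow> (real \<Rightarrow> vec3) \<Rightarrow> real \<Rightarrow> vector_field set" where
  "dom_Lplus q D \<omega> t = {u \<in> Lp_sigma q D \<inter> W10 q D \<inter> W2 q D.
     (\<lambda>x. wadvect D (cross3 (\<omega> t) x) u x) \<in> Lp q D}"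

definition Lplus ::
  "real \<Rightarrow> vec3 set \<Rightarrow> (real \<Rightarrow> vec3) \<Rightarrow> (real \<Rightarrow> vec3) \<Rightarrow> real \<Rightarrow> vector_field \<Rightarrow> vector_field" where
  "Lplus q D \<eta> \<omega> t u = (\<lambda>x. - helmholtz q D
     (\<lambda>y. wlaplace D u y + wadvect D (\<eta> t + cross3 (\<omega> t) y) u y - cross3 (\<omega> t) (u y)) x)"

text \<open>
  Strong solutions on \<open>[s,\<infinity>)\<close> of \<open>du/dt + L\<^sub>+(t)u = 0\<close>, \<open>u(s) = g\<close>: continuous on \<open>[s,\<infinity>)\<close>
  and \<open>C\<^sup>1\<close> on \<open>(s,\<infinity>)\<close> with values in \<open>L\<^sup>q\<^sub>\<sigma>(D)\<close>.
\<close>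

definition strong_solution ::
  "real \<Rightarrow> vec3 set \<Rightarrow> (real \<Rightarrow> vec3) \<Rightarrow> (real \<Rightarrow> vec3) \<Rightarrow> real \<Rightarrow> vector_field
     \<Rightarrow> (real \<Rightarrow> vector_field) \<Rightarrow> bool" where
  "strong_solution q D \<eta> \<omega> s g u \<longleftrightarrow>
     (AE x in lebesgue_on D. u s x = g x) \<and>
     (\<forall>t\<ge>s. u t \<in> Lp_sigma q D \<and> Lp_tendsto q D u (u t) (at t within {s..})) \<and>
     (\<forall>t>s. u t \<in> dom_Lplus q D \<omega> t \<and>
        Lp_tendsto q D (\<lambda>h x. (u (t + h) x - u t x) /\<^sub>R h) (\<lambda>x. - Lplus q D \<eta> \<omega> t (u t) x) (at 0) \<and>
        Lp_tendsto q D (\<lambda>\<tau>. Lplus q D \<eta> \<omega> \<tau> (u \<tau>)) (Lplus q D \<eta> \<omega> t (u t)) (at t))"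

text \<open>
  \<open>T(t,s)\<close> is the solution operator \<open>g \<mapsto> u(t)\<close>.  Strong solutions exist for smooth initial
  values; since \<open>T(t,s)\<close> is bounded on \<open>L\<^sup>q\<^sub>\<sigma>(D)\<close>, its values at other \<open>g\<close> are obtained by
  approximation.
\<close>

definition evol ::
  "real \<Rightarrow> vec3 set \<Rightarrow> (real \<Rightarrow> vec3) \<Rightarrow> (real \<Rightarrow> vec3) \<Rightarrow> real \<Rightarrow> real \<Rightarrow> vector_field
     \<Rightarrow> vector_field" where
  "evol q D \<eta> \<omega> t s g = (SOME v. \<exists>G U.
     (\<forall>n. G n \<in> test_sigma D \<and> strong_solution q D \<eta> \<omega> s (G n) (U n)) \<and>
     Lp_tendsto q D G g sequentially \<and> Lp_tendsto q D (\<lambda>n. U n t) v sequentially)"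

text \<open>
  The extension of \<open>T(t,s) P div\<close> from smooth tensor fields to a bounded operator from
  \<open>L\<^sup>p(D)\<close>, \<open>3/2 \<le> p \<le> q\<close>, to \<open>L\<^sup>q\<^sub>\<sigma>(D)\<close>.  Its value at \<open>F\<close> is the same for all
  such \<open>p\<close> with \<open>F \<in> L\<^sup>p(D)\<close>.
\<close>

definition evol_P_div ::
  "real \<Rightarrow> vec3 set \<Rightarrow> (real \<Rightarrow> vec3) \<Rightarrow> (real \<Rightarrow> vec3) \<Rightarrow> real \<Rightarrow> real \<Rightarrow> tensor_field
     \<Rightarrow> vector_field" where
  "evol_P_div q D \<eta> \<omega> t s F = (SOME v. \<exists>p G. 3/2 \<le> p \<and> p \<le> q \<and>
     (\<forall>n. G n \<in> test_functions D) \<and> Lp_tendsto p D G F sequentially \<and>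
     Lp_tendsto q D (\<lambda>n. evol q D \<eta> \<omega> t s (helmholtz q D (div_tensor (G n)))) v sequentially)"

section \<open>Bochner integral with values in \<open>L\<^sup>q\<close>\<close>

definition has_Lp_bochner_integral ::
  "real \<Rightarrow> vec3 set \<Rightarrow> real set \<Rightarrow> (real \<Rightarrow> vector_field) \<Rightarrow> vector_field \<Rightarrow> bool" where
  "has_Lp_bochner_integral q \<Omega> I F v \<longleftrightarrow>
     (AE s in lebesgue_on I. F s \<in> Lp q \<Omega>) \<and>
     (\<exists>(N :: nat \<Rightarrow> nat) A g S.
        (\<forall>n. \<forall>i<N n. A n i \<in> lmeasurable \<and> A n i \<subseteq> I \<and> g n i \<in> Lp q \<Omega>) \<and>
        (\<forall>n s x. S n s x = (\<Sum>i<N n. indicator (A n i) s *\<^sub>R g n i x)) \<and>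
        (\<forall>n. (\<lambda>s. Lp_norm q \<Omega> (\<lambda>x. F s x - S n s x)) \<in> borel_measurable (lebesgue_on I)) \<and>
        (\<lambda>n. \<integral>\<^sup>+ s. ennreal (Lp_norm q \<Omega> (\<lambda>x. F s x - S n s x)) \<partial>lebesgue_on I) \<longlonglongrightarrow> 0 \<and>
        Lp_tendsto q \<Omega> (\<lambda>n x. \<Sum>i<N n. measure lebesgue (A n i) *\<^sub>R g n i x) v sequentially)"

section \<open>Rigid motion, lift and force\<close>

definition W1inf_C1 :: "(real \<Rightarrow> 'b::real_normed_vector) set" where
  "W1inf_C1 = {\<zeta>. \<zeta> C1_differentiable_on UNIV \<and> bounded (range \<zeta>) \<and>
                  bounded (range (\<lambda>t. vector_derivative \<zeta> (at t)))}"

definition W1inf_norm :: "(real \<Rightarrow> 'b::real_normed_vector) \<Rightarrow> real" where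
  "W1inf_norm \<zeta> = (SUP t. norm (\<zeta> t)) + (SUP t. norm (vector_derivative \<zeta> (at t)))"

definition cutoff :: "scalar_field \<Rightarrow> bool" where
  "cutoff \<phi> \<longleftrightarrow> \<phi> \<in> test_functions (ball 0 2) \<and> (\<forall>x\<in>ball 0 1. \<phi> x = 1)"

definition lift ::
  "scalar_field \<Rightarrow> (real \<Rightarrow> vec3) \<Rightarrow> (real \<Rightarrow> vec3) \<Rightarrow> real \<Rightarrow> vector_field" where
  "lift \<phi> \<eta> \<omega> t x =
     (1/2) *\<^sub>R rot (\<lambda>y. \<phi> y *\<^sub>R (cross3 (\<eta> t) y - (norm y)\<^sup>2 *\<^sub>R \<omega> t)) x"

definition force ::
  "scalar_field \<Rightarrow> (real \<Rightarrow> vec3) \<Rightarrow> (real \<Rightarrow> vec3) \<Rightarrow> real \<Rightarrow> vector_field" where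
  "force \<phi> \<eta> \<omega> t x = (let b = lift \<phi> \<eta> \<omega> in
     laplace (b t) x + advect (\<eta> t + cross3 (\<omega> t) x) (b t) x - cross3 (\<omega> t) (b t x)
     - vector_derivative (\<lambda>\<tau>. b \<tau> x) (at t) - advect (b t x) (b t) x)"

definition conv_tensor ::
  "scalar_field \<Rightarrow> (real \<Rightarrow> vec3) \<Rightarrow> (real \<Rightarrow> vec3) \<Rightarrow> (real \<Rightarrow> vector_field) \<Rightarrow> real
     \<Rightarrow> tensor_field" where
  "conv_tensor \<phi> \<eta> \<omega> u t x = (let b = lift \<phi> \<eta> \<omega> in
     u t x \<otimes>\<^sub>t u t x + u t x \<otimes>\<^sub>t b t x + b t x \<otimes>\<^sub>t u t x)"

section \<open>The solution and its pressure\<close>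

text \<open>
  The integrals converge in \<open>L\<^sup>q\<^sub>\<sigma>(D)\<close> for \<open>q \<in> (3,\<infinity>)\<close>, and the equation is understood there for
  all these \<open>q\<close>.
\<close>

definition integral_equation ::
  "vec3 set \<Rightarrow> scalar_field \<Rightarrow> (real \<Rightarrow> vec3) \<Rightarrow> (real \<Rightarrow> vec3) \<Rightarrow> (real \<Rightarrow> vector_field) \<Rightarrow> bool" where
  "integral_equation D \<phi> \<eta> \<omega> u \<longleftrightarrow> (\<forall>q>3. \<forall>t. u t \<in> Lp_sigma q D \<and> (\<exists>v w.
     has_Lp_bochner_integral q D {..t}
       (\<lambda>s. evol q D \<eta> \<omega> t s (helmholtz q D (force \<phi> \<eta> \<omega> s))) v \<and>
     has_Lp_bochner_integral q D {..t}
       (\<lambda>s. evol_P_div q D \<eta> \<omega> t s (conv_tensor \<phi> \<eta> \<omega> u s)) w \<and>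
     (AE x in lebesgue_on D. u t x = v x - w x)))"

definition is_solution ::
  "vec3 set \<Rightarrow> scalar_field \<Rightarrow> real \<Rightarrow> (real \<Rightarrow> vec3) \<Rightarrow> (real \<Rightarrow> vec3) \<Rightarrow> (real \<Rightarrow> vector_field)
     \<Rightarrow> bool" where
  "is_solution D \<phi> C \<eta> \<omega> u \<longleftrightarrow>
     (\<forall>t. u t \<in> Lorentz_sigma 3 \<infinity> D) \<and>
     (\<forall>\<psi>\<in>Lorentz_sigma (3/2) 1 D. continuous_on UNIV (\<lambda>t. pairing D (u t) \<psi>)) \<and>
     (\<forall>t. Lorentz_norm 3 \<infinity> D (u t) \<le> C * W1inf_norm (\<lambda>t. (\<eta> t, \<omega> t))) \<and>
     integral_equation D \<phi> \<eta> \<omega> u"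

text \<open>
  \<open>\<langle>\<partial>\<^sub>tu(t), \<psi>\<rangle>\<close> is by definition \<open>d/dt \<langle>u(t), \<psi>\<rangle>\<close>.
\<close>

definition momentum_equation ::
  "vec3 set \<Rightarrow> scalar_field \<Rightarrow> (real \<Rightarrow> vec3) \<Rightarrow> (real \<Rightarrow> vec3) \<Rightarrow> (real \<Rightarrow> vector_field)
     \<Rightarrow> (real \<Rightarrow> scalar_field) \<Rightarrow> bool" where
  "momentum_equation D \<phi> \<eta> \<omega> u p \<longleftrightarrow> (\<forall>t. \<forall>\<psi>\<in>test_functions D.
     deriv (\<lambda>\<tau>. pairing D (u \<tau>) \<psi>) t
     + pairing D (\<lambda>x. wgrad D (u t) x + u t x \<otimes>\<^sub>t (\<eta> t + cross3 (\<omega> t) x)) (grad \<psi>)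
     + pairing D (\<lambda>x. cross3 (\<omega> t) (u t x)) \<psi>
     - pairing D (p t) (divg \<psi>)
     = pairing D (conv_tensor \<phi> \<eta> \<omega> u t) (grad \<psi>) + pairing D (force \<phi> \<eta> \<omega> t) \<psi>)"

definition associated_pressure ::
  "vec3 set \<Rightarrow> scalar_field \<Rightarrow> (real \<Rightarrow> vec3) \<Rightarrow> (real \<Rightarrow> vec3) \<Rightarrow> (real \<Rightarrow> vector_field)
     \<Rightarrow> real \<Rightarrow> real \<Rightarrow> (real \<Rightarrow> scalar_field) \<Rightarrow> bool" where
  "associated_pressure D \<phi> \<eta> \<omega> u R r p \<longleftrightarrow>
     (\<forall>t. loc_integrable D (p t)) \<and>
     BC_weak (Lp r (trunc D R)) (Lp_norm r (trunc D R)) p \<and>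
     momentum_equation D \<phi> \<eta> \<omega> u p \<and>
     (\<forall>t. (LINT x|lebesgue_on (trunc D R). p t x) = 0)"

text \<open>\<open>K q\<close> is the constant \<open>C(q,D)\<close> in the estimate of the higher norms.\<close>

definition solution_regularity ::
  "vec3 set \<Rightarrow> scalar_field \<Rightarrow> (real \<Rightarrow> real) \<Rightarrow> (real \<Rightarrow> vec3) \<Rightarrow> (real \<Rightarrow> vec3)
     \<Rightarrow> (real \<Rightarrow> vector_field) \<Rightarrow> bool" where
  "solution_regularity D \<phi> K \<eta> \<omega> u \<longleftrightarrow>
     (\<forall>q>3. (\<forall>t. u t \<in> Lp_sigma q D \<and> Lp_tendsto q D u (u t) (at t)) \<and>
            BC_weak (W10 q D) (W1_norm q D) u \<and>
            (\<forall>t. Lp_norm q D (u t) + Lp_norm q D (wgrad D (u t))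
                   \<le> K q * W1inf_norm (\<lambda>t. (\<eta> t, \<omega> t)))) \<and>
     (\<forall>R>2. \<forall>r>1.
        C1_weak (Wneg r (trunc D R)) (Wneg_norm r (trunc D R)) (\<lambda>t. pairing (trunc D R) (u t)) \<and>
        (\<exists>p. associated_pressure D \<phi> \<eta> \<omega> u R r p))"

text \<open>
  \<open>\<delta>\<close> is a smallness threshold below which the integral equation is uniquely solvable, with \<open>C\<close>
  the constant \<open>C(D)\<close> delimiting the uniqueness class.
\<close>

definition smallness_constants :: "vec3 set \<Rightarrow> scalar_field \<Rightarrow> real \<Rightarrow> real \<Rightarrow> bool" where
  "smallness_constants D \<phi> \<delta> C \<longleftrightarrow> 0 < \<delta> \<and> \<delta> \<le> 1 \<and>
     (\<exists>K. \<forall>\<eta>\<in>W1inf_C1. \<forall>\<omega>\<in>W1inf_C1. W1inf_norm (\<lambda>t. (\<eta> t, \<omega> t)) \<le> \<delta> \<longrightarrow>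
        (\<exists>u. is_solution D \<phi> C \<eta> \<omega> u \<and> solution_regularity D \<phi> K \<eta> \<omega> u \<and>
             (\<forall>v. is_solution D \<phi> C \<eta> \<omega> v \<longrightarrow>
                  (\<forall>t. AE x in lebesgue_on D. v t x = u t x))))"

end

theory Submission
  imports Defs
begin

text \<open>
  If \<open>\<eta>\<close> and \<open>\<omega>\<close> are \<open>l\<close>-periodic, then the evolution operator, the force and the lift are invariant
  under simultaneous translation of all times by \<open>l\<close>.  Hence \<open>u(\<cdot> + l)\<close> solves the same integral
  equation in the same uniqueness class as \<open>u\<close>, and the two agree.  The momentum equations at
  \<open>t + l\<close> and \<open>t\<close> then differ only in the pressure term, so \<open>p(t + l) - p(t)\<close> has vanishing
  distributional gradient on the connected set \<open>D\<close>; it is a constant, which is zero because both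
  pressures have integral zero over \<open>D\<^sub>R\<close>.
\<close>

section \<open>Time translation\<close>

text \<open>Classical derivatives, weak gradients, the projection and the evolution operator are all
  representatives picked by a choice operator, so equality almost everywhere is not enough when they
  are nested. Their invariance is therefore shown on the defining predicates: these agree for every
  candidate, and the chosen objects are literally equal. The analytic weight lies in the constancy
  of \<open>p (t + l) - p t\<close>. This difference is merely locally integrable and is tested only
  against derivatives of smooth functions. Smoothing it by a kernel makes it differentiable with
  derivative zero, hence constant on a ball, but the constant may still depend on the kernel;
  comparison with one fixed bump identifies the limit as the kernels shrink. The kernels are squares
  of dilates of \<phi>, so the cutoff from the lift doubles as the source of smooth bumps. Passing
  from balls to D has a second difficulty: each ball brings its own null set, and there are
  uncountably many balls.\<close>

lemma vector_derivative_shift: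
  fixes f :: "real \<Rightarrow> 'b::real_normed_vector"
  shows "vector_derivative (\<lambda>s. f (s + l)) (at t) = vector_derivative f (at (t + l))"
proof -
  \<comment> \<open>The equivalence for every y makes the choice in \<open>vector_derivative\<close>
    the same on both sides, also where no derivative exists.\<close>
  have "((\<lambda>s. f (s + l)) has_vector_derivative y) (at t) \<longleftrightarrow>
        (f has_vector_derivative y) (at (t + l))" for y
    unfolding has_vector_derivative_def has_derivative_at
    by (simp add: add.assoc add.commute[of l])
  then show ?thesis
    by (simp add: vector_derivative_def)
qed

lemma deriv_shift: "deriv (\<lambda>s. f (s + l)) t = deriv f (t + l)"
  by (simp add: deriv_def DERIV_shift)

lemma Lp_tendsto_filtermap:
  "Lp_tendsto q D u g (filtermap h F) \<longleftrightarrow> Lp_tendsto q D (\<lambda>i. u (h i)) g F"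
  by (simp add: Lp_tendsto_def eventually_filtermap filterlim_filtermap)

text \<open>Continuity of a strong solution at its initial time is one-sided, so the half-line has
  to move together with the base point.\<close>

lemma filtermap_at_within_atLeast_shift:
  fixes s t l :: real
  shows "filtermap (\<lambda>\<tau>. \<tau> + l) (at t within {s..}) = at (t + l) within {s + l..}"
proof (rule filtermap_fun_inverse[where g = "\<lambda>\<tau>. \<tau> - l"])
  show "filterlim (\<lambda>\<tau>. \<tau> - l) (at t within {s..}) (at (t + l) within {s + l..})"
    unfolding filterlim_at by (auto intro!: tendsto_eq_intros simp: eventually_at_filter)
  show "filterlim (\<lambda>\<tau>. \<tau> + l) (at (t + l) within {s + l..}) (at t within {s..})"
    unfolding filterlim_at by (auto intro!: tendsto_eq_intros simp: eventually_at_filter)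
qed simp

lemma filtermap_at_add:
  fixes t l :: real
  shows "filtermap (\<lambda>\<tau>. \<tau> + l) (at t) = at (t + l)"
  using filtermap_at_shift[of "-l" t] by simp

text \<open>Periodicity makes \<open>Lplus\<close> and its domain the same at t and t + l. What
  remains is a change of variable in the limits, obtained by writing the filter at t + l as the
  image of the filter at t.\<close>

lemma strong_solution_shift:
  assumes "strong_solution q D \<eta> \<omega> (s + l) g u"
    and \<eta>: "\<And>t. \<eta> (t + l) = \<eta> t" and \<omega>: "\<And>t. \<omega> (t + l) = \<omega> t"
  shows "strong_solution q D \<eta> \<omega> s g (\<lambda>t. u (t + l))"
proof -
  have L: "Lplus q D \<eta> \<omega> (t + l) = Lplus q D \<eta> \<omega> t" for t
    by (simp add: Lplus_def fun_eq_iff \<eta> \<omega>)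
  have d: "dom_Lplus q D \<omega> (t + l) = dom_Lplus q D \<omega> t" for t
    by (simp add: dom_Lplus_def \<omega>)
  show ?thesis
    unfolding strong_solution_def
  proof (intro conjI allI impI)
    show "AE x in lebesgue_on D. u (s + l) x = g x"
      using assms(1) by (simp add: strong_solution_def)
    fix t assume "s \<le> t"
    then have "s + l \<le> t + l" by simp
    then have *: "u (t + l) \<in> Lp_sigma q D" "Lp_tendsto q D u (u (t + l)) (at (t + l) within {s + l..})"
      using assms(1) unfolding strong_solution_def by blast+
    show "u (t + l) \<in> Lp_sigma q D" by fact
    show "Lp_tendsto q D (\<lambda>t. u (t + l)) (u (t + l)) (at t within {s..})"
      using *(2) unfolding filtermap_at_within_atLeast_shift[symmetric, of t l s] Lp_tendsto_filtermap .
  next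
    fix t assume "s < t"
    then have "s + l < t + l" by simp
    then have *: "u (t + l) \<in> dom_Lplus q D \<omega> (t + l)"
      "Lp_tendsto q D (\<lambda>h x. (u (t + l + h) x - u (t + l) x) /\<^sub>R h)
         (\<lambda>x. - Lplus q D \<eta> \<omega> (t + l) (u (t + l)) x) (at 0)"
      "Lp_tendsto q D (\<lambda>\<tau>. Lplus q D \<eta> \<omega> \<tau> (u \<tau>)) (Lplus q D \<eta> \<omega> (t + l) (u (t + l))) (at (t + l))"
      using assms(1) unfolding strong_solution_def by blast+
    show "u (t + l) \<in> dom_Lplus q D \<omega> t"
      using *(1) by (simp add: d)
    show "Lp_tendsto q D (\<lambda>h x. (u (t + h + l) x - u (t + l) x) /\<^sub>R h)
         (\<lambda>x. - Lplus q D \<eta> \<omega> t (u (t + l)) x) (at 0)"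
      using *(2) unfolding L by (simp add: add.assoc add.commute[of l])
    show "Lp_tendsto q D (\<lambda>\<tau>. Lplus q D \<eta> \<omega> \<tau> (u (\<tau> + l))) (Lplus q D \<eta> \<omega> t (u (t + l))) (at t)"
      using *(3) unfolding filtermap_at_add[symmetric, of t l] Lp_tendsto_filtermap L .
  qed
qed

lemma strong_solution_shift_iff:
  assumes \<eta>: "\<And>t. \<eta> (t + l) = \<eta> t" and \<omega>: "\<And>t. \<omega> (t + l) = \<omega> t"
  shows "strong_solution q D \<eta> \<omega> (s + l) g u \<longleftrightarrow> strong_solution q D \<eta> \<omega> s g (\<lambda>t. u (t + l))"
proof
  show "strong_solution q D \<eta> \<omega> s g (\<lambda>t. u (t + l))" if "strong_solution q D \<eta> \<omega> (s + l) g u"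
    using strong_solution_shift[of q D \<eta> \<omega> s l, OF that \<eta> \<omega>] .
  \<comment> \<open>The data are also periodic with period -l, so the converse is the forward lemma
    applied to the translated solution with start s + l and shift -l.\<close>
  have "\<eta> (t + - l) = \<eta> t" "\<omega> (t + - l) = \<omega> t" for t
    using \<eta>[of "t - l"] \<omega>[of "t - l"] by simp_all
  then show "strong_solution q D \<eta> \<omega> (s + l) g u" if "strong_solution q D \<eta> \<omega> s g (\<lambda>t. u (t + l))"
    using strong_solution_shift[of q D \<eta> \<omega> "s + l" "- l" g "\<lambda>t. u (t + l)"] that
    unfolding add.assoc add.right_inverse add.left_inverse add_0_right by blast
qed

text \<open>The approximating initial values \<open>G\<close> are kept and only the solutions
  \<open>U\<close> are translated. This maps the witnesses for one choice predicate to witnesses for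
  the other, in both directions and for each v, so \<open>SOME\<close> returns the same
  function.\<close>

lemma evol_shift:
  assumes \<eta>: "\<And>t. \<eta> (t + l) = \<eta> t" and \<omega>: "\<And>t. \<omega> (t + l) = \<omega> t"
  shows "evol q D \<eta> \<omega> (t + l) (s + l) g = evol q D \<eta> \<omega> t s g"
proof -
  have "(\<exists>G U. (\<forall>n. G n \<in> test_sigma D \<and> strong_solution q D \<eta> \<omega> (s + l) (G n) (U n)) \<and>
          Lp_tendsto q D G g sequentially \<and> Lp_tendsto q D (\<lambda>n. U n (t + l)) v sequentially) \<longleftrightarrow>
        (\<exists>G U. (\<forall>n. G n \<in> test_sigma D \<and> strong_solution q D \<eta> \<omega> s (G n) (U n)) \<and>
          Lp_tendsto q D G g sequentially \<and> Lp_tendsto q D (\<lambda>n. U n t) v sequentially)"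
    (is "?A \<longleftrightarrow> ?B") for v
  proof
    show ?B if ?A
    proof -
      from that obtain G U where
        "\<forall>n. G n \<in> test_sigma D \<and> strong_solution q D \<eta> \<omega> (s + l) (G n) (U n)"
        "Lp_tendsto q D G g sequentially" "Lp_tendsto q D (\<lambda>n. U n (t + l)) v sequentially"
        by blast
      moreover from this(1) have "strong_solution q D \<eta> \<omega> s (G n) (\<lambda>t. U n (t + l))" for n
        using strong_solution_shift[of q D \<eta> \<omega> s l "G n" "U n", OF _ \<eta> \<omega>] by blast
      ultimately show ?B
        by (intro exI[of _ G] exI[of _ "\<lambda>n t. U n (t + l)"]) simp
    qed
    show ?A if ?B
    proof -
      from that obtain G U where
        "\<forall>n. G n \<in> test_sigma D \<and> strong_solution q D \<eta> \<omega> s (G n) (U n)"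
        "Lp_tendsto q D G g sequentially" "Lp_tendsto q D (\<lambda>n. U n t) v sequentially"
        by blast
      moreover from this(1) have "strong_solution q D \<eta> \<omega> (s + l) (G n) (\<lambda>t. U n (t - l))" for n
        using strong_solution_shift_iff[of \<eta> l \<omega> q D s "G n" "\<lambda>t. U n (t - l)", OF \<eta> \<omega>] by simp
      ultimately show ?A
        by (intro exI[of _ G] exI[of _ "\<lambda>n t. U n (t - l)"]) simp
    qed
  qed
  then show ?thesis
    by (simp add: evol_def)
qed

lemma evol_P_div_shift:
  assumes "\<And>t. \<eta> (t + l) = \<eta> t" and "\<And>t. \<omega> (t + l) = \<omega> t"
  shows "evol_P_div q D \<eta> \<omega> (t + l) (s + l) F = evol_P_div q D \<eta> \<omega> t s F"
  by (simp add: evol_P_div_def evol_shift[of \<eta> l \<omega>, OF assms])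

lemma lift_shift:
  assumes "\<And>t. \<eta> (t + l) = \<eta> t" and "\<And>t. \<omega> (t + l) = \<omega> t"
  shows "lift \<phi> \<eta> \<omega> (t + l) = lift \<phi> \<eta> \<omega> t"
  by (simp add: lift_def fun_eq_iff assms)

lemma force_shift:
  assumes "\<And>t. \<eta> (t + l) = \<eta> t" and "\<And>t. \<omega> (t + l) = \<omega> t"
  shows "force \<phi> \<eta> \<omega> (t + l) = force \<phi> \<eta> \<omega> t"
  using vector_derivative_shift[of "\<lambda>\<tau>. lift \<phi> \<eta> \<omega> \<tau> x" l t for x]
  by (simp add: force_def Let_def fun_eq_iff assms lift_shift[of \<eta> l \<omega>, OF assms])

lemma conv_tensor_shift:
  assumes "\<And>t. \<eta> (t + l) = \<eta> t" and "\<And>t. \<omega> (t + l) = \<omega> t"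
  shows "conv_tensor \<phi> \<eta> \<omega> u (t + l) = conv_tensor \<phi> \<eta> \<omega> (\<lambda>s. u (s + l)) t"
  by (simp add: conv_tensor_def Let_def fun_eq_iff lift_shift[of \<eta> l \<omega>, OF assms])

section \<open>Translation of integrals over half-lines\<close>

lemma distr_lebesgue_shift: "distr lebesgue lebesgue (\<lambda>s. s + l) = (lebesgue :: real measure)"
  using lebesgue_real_affine[of 1 l] by (simp add: density_1 add.commute)

lemma measurable_lebesgue_shift [measurable]: "(\<lambda>s. s + l) \<in> lebesgue \<rightarrow>\<^sub>M (lebesgue :: real measure)"
  using lebesgue_affine_measurable[of "\<lambda>_. 1" l] by (simp add: add.commute)

lemma measurable_lebesgue_on_shift:
  fixes t l :: real
  shows "(\<lambda>s. s + l) \<in> lebesgue_on {..t} \<rightarrow>\<^sub>M lebesgue_on {..t + l}"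
proof (rule measurable_restrict_space2)
  show "(\<lambda>s. s + l) \<in> space (lebesgue_on {..t}) \<rightarrow> {..t + l}"
    by (simp add: space_restrict_space)
  show "(\<lambda>s. s + l) \<in> lebesgue_on {..t} \<rightarrow>\<^sub>M lebesgue"
    by (rule measurable_restrict_space1) simp
qed

lemma distr_lebesgue_on_shift:
  fixes t l :: real
  shows "distr (lebesgue_on {..t}) (lebesgue_on {..t + l}) (\<lambda>s. s + l) = lebesgue_on {..t + l}"
proof (rule measure_eqI)
  fix A assume "A \<in> sets (distr (lebesgue_on {..t}) (lebesgue_on {..t + l}) (\<lambda>s. s + l))"
  then have A: "A \<in> sets (lebesgue_on {..t + l})" by simp
  then have A': "A \<in> sets lebesgue" "A \<subseteq> {..t + l}"
    by (auto simp: sets_restrict_space)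
  \<comment> \<open>A set inside \<open>{..t + l}\<close> has its preimage inside
    \<open>{..t}\<close>, so the restriction to the half-line costs nothing and the claim reduces to
    translation invariance on the whole line.\<close>
  have eq: "(\<lambda>s. s + l) -` A \<inter> {..t} = (\<lambda>s. s + l) -` A"
    using A'(2) by force
  have "emeasure (distr (lebesgue_on {..t}) (lebesgue_on {..t + l}) (\<lambda>s. s + l)) A =
      emeasure (lebesgue_on {..t}) ((\<lambda>s. s + l) -` A)"
    by (simp add: emeasure_distr[OF measurable_lebesgue_on_shift A] eq)
  also have "\<dots> = emeasure lebesgue ((\<lambda>s. s + l) -` A)"
    using A' by (intro emeasure_restrict_space) auto
  also have "\<dots> = emeasure (distr lebesgue lebesgue (\<lambda>s. s + l)) A"
    using A' by (subst emeasure_distr) auto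
  also have "\<dots> = emeasure (lebesgue_on {..t + l}) A"
    unfolding distr_lebesgue_shift using A' by (subst emeasure_restrict_space) auto
  finally show "emeasure (distr (lebesgue_on {..t}) (lebesgue_on {..t + l}) (\<lambda>s. s + l)) A =
    emeasure (lebesgue_on {..t + l}) A" .
qed simp

text \<open>The approximating simple functions are translated along with the integrand. The
  translated sets have the same measure, so the elementary integrals are unchanged term by term and
  have the same limit v; the error integrals agree by the image measure formula.\<close>

lemma has_Lp_bochner_integral_shift:
  assumes "has_Lp_bochner_integral q \<Omega> {..t + l} F v"
  shows "has_Lp_bochner_integral q \<Omega> {..t} (\<lambda>s. F (s + l)) v"
proof -
  note m = measurable_lebesgue_on_shift[of l t]
  obtain N :: "nat \<Rightarrow> nat" and A g S where AE: "AE s in lebesgue_on {..t + l}. F s \<in> Lp q \<Omega>"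
    and 1: "\<And>n i. i < N n \<Longrightarrow> A n i \<in> lmeasurable \<and> A n i \<subseteq> {..t + l} \<and> g n i \<in> Lp q \<Omega>"
    and 2: "\<And>n s x. S n s x = (\<Sum>i<N n. indicator (A n i) s *\<^sub>R g n i x)"
    and 3: "\<And>n. (\<lambda>s. Lp_norm q \<Omega> (\<lambda>x. F s x - S n s x)) \<in> borel_measurable (lebesgue_on {..t + l})"
    and 4: "(\<lambda>n. \<integral>\<^sup>+ s. ennreal (Lp_norm q \<Omega> (\<lambda>x. F s x - S n s x)) \<partial>lebesgue_on {..t + l})
       \<longlonglongrightarrow> 0"
    and 5: "Lp_tendsto q \<Omega> (\<lambda>n x. \<Sum>i<N n. measure lebesgue (A n i) *\<^sub>R g n i x) v sequentially"
    using assms unfolding has_Lp_bochner_integral_def by (elim conjE exE) (rule that; simp)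
  define A' where "A' n i = (\<lambda>s. s + l) -` A n i" for n i
  have meas: "emeasure lebesgue (A' n i) = emeasure lebesgue (A n i)" "A' n i \<in> sets lebesgue"
    if "i < N n" for n i
  proof -
    have A: "A n i \<in> sets lebesgue" using 1[OF that] by (auto simp: fmeasurable_def)
    show "A' n i \<in> sets lebesgue"
      using measurable_sets[OF measurable_lebesgue_shift A, of l] by (simp add: A'_def)
    show "emeasure lebesgue (A' n i) = emeasure lebesgue (A n i)"
      using emeasure_distr[OF measurable_lebesgue_shift A, of l]
      by (simp add: distr_lebesgue_shift A'_def)
  qed
  have "AE s in lebesgue_on {..t}. F (s + l) \<in> Lp q \<Omega>"
    using AE_distrD[OF m, of "\<lambda>s. F s \<in> Lp q \<Omega>"] AE
    unfolding distr_lebesgue_on_shift by blast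
  moreover have "A' n i \<in> lmeasurable \<and> A' n i \<subseteq> {..t} \<and> g n i \<in> Lp q \<Omega>" if "i < N n" for n i
    using 1[OF that] meas[OF that] by (auto simp: fmeasurable_def) (auto simp: A'_def)
  moreover have "S n (s + l) x = (\<Sum>i<N n. indicator (A' n i) s *\<^sub>R g n i x)" for n s x
    by (simp add: 2 A'_def indicator_def)
  moreover have "(\<lambda>s. Lp_norm q \<Omega> (\<lambda>x. F (s + l) x - S n (s + l) x)) \<in>
      borel_measurable (lebesgue_on {..t})" for n
    using measurable_compose[OF m 3] .
  moreover have "(\<lambda>n. \<integral>\<^sup>+ s. ennreal (Lp_norm q \<Omega> (\<lambda>x. F (s + l) x - S n (s + l) x))
      \<partial>lebesgue_on {..t}) \<longlonglongrightarrow> 0"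
  proof -
    have "(\<integral>\<^sup>+ s. ennreal (Lp_norm q \<Omega> (\<lambda>x. F s x - S n s x)) \<partial>lebesgue_on {..t + l}) =
      (\<integral>\<^sup>+ s. ennreal (Lp_norm q \<Omega> (\<lambda>x. F (s + l) x - S n (s + l) x)) \<partial>lebesgue_on {..t})" for n
      using nn_integral_distr[OF m, of "\<lambda>s. ennreal (Lp_norm q \<Omega> (\<lambda>x. F s x - S n s x))"] 3[of n]
      unfolding distr_lebesgue_on_shift by simp
    then show ?thesis using 4 by simp
  qed
  moreover have "Lp_tendsto q \<Omega> (\<lambda>n x. \<Sum>i<N n. measure lebesgue (A' n i) *\<^sub>R g n i x) v sequentially"
  proof -
    have "(\<Sum>i<N n. measure lebesgue (A' n i) *\<^sub>R g n i x) =
      (\<Sum>i<N n. measure lebesgue (A n i) *\<^sub>R g n i x)" for n x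
      by (intro sum.cong refl) (simp only: measure_def meas(1) lessThan_iff)
    then show ?thesis using 5 by simp
  qed
  ultimately show ?thesis
    unfolding has_Lp_bochner_integral_def
    by (intro conjI exI[of _ N] exI[of _ A'] exI[of _ g] exI[of _ "\<lambda>n s. S n (s + l)"]) blast+
qed

text \<open>Translating the integration variable turns the operator from s + l to t + l into the one
  from s to t. The translate stays in the uniqueness class with the same \<open>C\<close>, because
  the bound on the Lorentz norm is uniform in time and its right-hand side involves only the data
  \<eta>, \<omega>.\<close>

lemma is_solution_shift:
  assumes sol: "is_solution D \<phi> C \<eta> \<omega> u"
    and \<eta>: "\<And>t. \<eta> (t + l) = \<eta> t" and \<omega>: "\<And>t. \<omega> (t + l) = \<omega> t"
  shows "is_solution D \<phi> C \<eta> \<omega> (\<lambda>t. u (t + l))"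
proof -
  note per = \<eta> \<omega>
  have "integral_equation D \<phi> \<eta> \<omega> (\<lambda>t. u (t + l))"
    unfolding integral_equation_def
  proof (intro allI impI)
    fix q t :: real
    assume "3 < q"
    then obtain v w where "u (t + l) \<in> Lp_sigma q D"
      and v: "has_Lp_bochner_integral q D {..t + l}
        (\<lambda>s. evol q D \<eta> \<omega> (t + l) s (helmholtz q D (force \<phi> \<eta> \<omega> s))) v"
      and w: "has_Lp_bochner_integral q D {..t + l}
        (\<lambda>s. evol_P_div q D \<eta> \<omega> (t + l) s (conv_tensor \<phi> \<eta> \<omega> u s)) w"
      and "AE x in lebesgue_on D. u (t + l) x = v x - w x"
      using sol unfolding is_solution_def integral_equation_def by blast
    then show "u (t + l) \<in> Lp_sigma q D \<and> (\<exists>v w.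
     has_Lp_bochner_integral q D {..t}
       (\<lambda>s. evol q D \<eta> \<omega> t s (helmholtz q D (force \<phi> \<eta> \<omega> s))) v \<and>
     has_Lp_bochner_integral q D {..t}
       (\<lambda>s. evol_P_div q D \<eta> \<omega> t s (conv_tensor \<phi> \<eta> \<omega> (\<lambda>t. u (t + l)) s)) w \<and>
     (AE x in lebesgue_on D. u (t + l) x = v x - w x))"
      using has_Lp_bochner_integral_shift[OF v] has_Lp_bochner_integral_shift[OF w]
      by (auto simp: evol_shift[of \<eta> l \<omega>, OF per] evol_P_div_shift[of \<eta> l \<omega>, OF per]
          force_shift[of \<eta> l \<omega>, OF per] conv_tensor_shift[of \<eta> l \<omega>, OF per])
  qed
  moreover have "continuous_on UNIV (\<lambda>t. pairing D (u (t + l)) \<psi>)"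
    if "continuous_on UNIV (\<lambda>t. pairing D (u t) \<psi>)" for \<psi>
    by (rule continuous_on_compose2[OF that]) (auto intro!: continuous_intros)
  ultimately show ?thesis
    using sol by (simp add: is_solution_def)
qed

section \<open>Calculus of test functions\<close>

text \<open>Every calculus rule for \<open>partial\<close> is derived through this from the
  corresponding rule for Frechet derivatives.\<close>

lemma partial_eq_derivative:
  assumes "(f has_derivative f') (at x)"
  shows "partial j f x = f' (axis j 1)"
proof -
  have "((\<lambda>h. f (x + h *\<^sub>R axis j 1)) has_derivative (\<lambda>h. f' (h *\<^sub>R axis j 1))) (at 0)"
    by (rule has_derivative_compose[where f = "\<lambda>h. x + h *\<^sub>R axis j 1" and g = f and g' = f'])
      (use assms in \<open>auto intro!: derivative_eq_intros\<close>)
  moreover have "(\<lambda>h. f' (h *\<^sub>R axis j 1)) = (\<lambda>h. h *\<^sub>R f' (axis j 1))"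
    using has_derivative_linear[OF assms] by (simp add: linear_cmul)
  ultimately show ?thesis
    unfolding partial_def by (intro vector_derivative_at) (simp add: has_vector_derivative_def)
qed

lemma has_derivative_partial:
  fixes f :: "vec3 \<Rightarrow> 'b::real_normed_vector"
  assumes "f differentiable (at x)"
  shows "(f has_derivative (\<lambda>h. \<Sum>j\<in>UNIV. (h $ j) *\<^sub>R partial j f x)) (at x)"
proof -
  obtain f' where f': "(f has_derivative f') (at x)"
    using assms by (auto simp: differentiable_def)
  have "f' = (\<lambda>h. \<Sum>j\<in>UNIV. (h $ j) *\<^sub>R partial j f x)"
  proof
    fix h
    have "f' h = f' (\<Sum>j\<in>UNIV. (h $ j) *\<^sub>R axis j 1)"
      using basis_expansion[of h] by (simp add: scalar_mult_eq_scaleR)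
    also have "\<dots> = (\<Sum>j\<in>UNIV. (h $ j) *\<^sub>R f' (axis j 1))"
      using has_derivative_linear[OF f'] by (simp add: linear_sum linear_cmul)
    finally show "f' h = (\<Sum>j\<in>UNIV. (h $ j) *\<^sub>R partial j f x)"
      by (simp add: partial_eq_derivative[OF f'])
  qed
  with f' show ?thesis by simp
qed

lemma partial_mult:
  fixes f g :: "vec3 \<Rightarrow> real"
  assumes "f differentiable (at x)" "g differentiable (at x)"
  shows "partial j (\<lambda>x. f x * g x) x = f x * partial j g x + partial j f x * g x"
proof -
  obtain f' g' where d: "(f has_derivative f') (at x)" "(g has_derivative g') (at x)"
    using assms by (auto simp: differentiable_def)
  show ?thesis
    using partial_eq_derivative[OF has_derivative_mult[OF d], of j]
    by (simp add: partial_eq_derivative[OF d(1)] partial_eq_derivative[OF d(2)])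
qed

lemma partial_add:
  assumes "f differentiable (at x)" "g differentiable (at x)"
  shows "partial j (\<lambda>x. f x + g x) x = partial j f x + partial j g x"
proof -
  obtain f' g' where d: "(f has_derivative f') (at x)" "(g has_derivative g') (at x)"
    using assms by (auto simp: differentiable_def)
  show ?thesis
    using partial_eq_derivative[OF has_derivative_add[OF d], of j]
    by (simp add: partial_eq_derivative[OF d(1)] partial_eq_derivative[OF d(2)])
qed

lemma partial_affine:
  fixes f :: "vec3 \<Rightarrow> 'b::real_normed_vector"
  assumes "f differentiable (at (a *\<^sub>R (x - z)))"
  shows "partial j (\<lambda>x. c *\<^sub>R f (a *\<^sub>R (x - z))) x = (c * a) *\<^sub>R partial j f (a *\<^sub>R (x - z))"
    and "(\<lambda>x. c *\<^sub>R f (a *\<^sub>R (x - z))) differentiable (at x)"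
proof -
  obtain f' where f': "(f has_derivative f') (at (a *\<^sub>R (x - z)))"
    using assms by (auto simp: differentiable_def)
  have "((\<lambda>x. a *\<^sub>R (x - z)) has_derivative (\<lambda>h. a *\<^sub>R h)) (at x)"
    by (auto intro!: derivative_eq_intros)
  from has_derivative_scaleR_right[OF has_derivative_compose[OF this f'], of c]
  have *: "((\<lambda>x. c *\<^sub>R f (a *\<^sub>R (x - z))) has_derivative (\<lambda>h. c *\<^sub>R f' (a *\<^sub>R h))) (at x)" .
  then show "(\<lambda>x. c *\<^sub>R f (a *\<^sub>R (x - z))) differentiable (at x)"
    by (auto simp: differentiable_def)
  show "partial j (\<lambda>x. c *\<^sub>R f (a *\<^sub>R (x - z))) x = (c * a) *\<^sub>R partial j f (a *\<^sub>R (x - z))"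
    using has_derivative_linear[OF f']
    by (simp add: partial_eq_derivative[OF *] partial_eq_derivative[OF f'] linear_cmul)
qed

lemma partial_scaleR_const:
  fixes f :: "vec3 \<Rightarrow> real"
  assumes "f differentiable (at x)"
  shows "partial j (\<lambda>x. f x *\<^sub>R v) x = partial j f x *\<^sub>R v"
    and "(\<lambda>x. f x *\<^sub>R v) differentiable (at x)"
proof -
  obtain f' where f': "(f has_derivative f') (at x)"
    using assms by (auto simp: differentiable_def)
  have *: "((\<lambda>x. f x *\<^sub>R v) has_derivative (\<lambda>h. f' h *\<^sub>R v)) (at x)"
    using f' by (auto intro!: derivative_eq_intros)
  then show "(\<lambda>x. f x *\<^sub>R v) differentiable (at x)"
    by (auto simp: differentiable_def)
  show "partial j (\<lambda>x. f x *\<^sub>R v) x = partial j f x *\<^sub>R v"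
    by (simp add: partial_eq_derivative[OF *] partial_eq_derivative[OF f'])
qed

text \<open>The product rule leaves one factor undifferentiated, and the induction for products
  needs that factor at the lower order.\<close>

lemma Ck_Suc_imp_Ck: "Ck (Suc k) f \<Longrightarrow> Ck k f"
proof (induction k arbitrary: f)
  case 0
  then show ?case
    by (auto intro!: continuous_at_imp_continuous_on differentiable_imp_continuous_within)
next
  case (Suc k)
  then show ?case by (metis Ck.simps(2))
qed

lemma Ck_add: "Ck k f \<Longrightarrow> Ck k g \<Longrightarrow> Ck k (\<lambda>x. f x + g x)"
proof (induction k arbitrary: f g)
  case 0
  then show ?case by (simp add: continuous_on_add)
next
  case (Suc k)
  note d = Suc.prems[unfolded Ck.simps(2)]
  have eq: "partial j (\<lambda>x. f x + g x) = (\<lambda>x. partial j f x + partial j g x)" for j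
    using d by (intro ext partial_add) blast+
  have "Ck k (\<lambda>x. partial j f x + partial j g x)" for j
    by (rule Suc.IH) (use d in blast)+
  then show ?case
    unfolding Ck.simps(2) eq using d by (blast intro: differentiable_add)
qed

lemma Ck_mult:
  fixes f g :: "vec3 \<Rightarrow> real"
  shows "Ck k f \<Longrightarrow> Ck k g \<Longrightarrow> Ck k (\<lambda>x. f x * g x)"
proof (induction k arbitrary: f g)
  case 0
  then show ?case by (simp add: continuous_on_mult)
next
  case (Suc k)
  note d = Suc.prems[unfolded Ck.simps(2)]
  have eq: "partial j (\<lambda>x. f x * g x) = (\<lambda>x. f x * partial j g x + partial j f x * g x)" for j
    using d by (intro ext partial_mult) blast+
  have "Ck k (\<lambda>x. f x * partial j g x + partial j f x * g x)" for j
    by (intro Ck_add Suc.IH[of f "partial j g"] Suc.IH[of "partial j f" g])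
      (use d Suc.prems[THEN Ck_Suc_imp_Ck] in blast)+
  then show ?case
    unfolding Ck.simps(2) eq using d by (blast intro: differentiable_mult)
qed

lemma Ck_affine:
  fixes f :: "vec3 \<Rightarrow> 'b::real_normed_vector"
  shows "Ck k f \<Longrightarrow> Ck k (\<lambda>x. c *\<^sub>R f (a *\<^sub>R (x - z)))"
\<comment> \<open>Each differentiation multiplies the prefactor by a, so c must vary in the
  induction.\<close>
proof (induction k arbitrary: f c)
  case 0
  then have "continuous_on UNIV (\<lambda>x. f (a *\<^sub>R (x - z)))"
    by (intro continuous_on_compose2[of UNIV f UNIV "\<lambda>x. a *\<^sub>R (x - z)"]) (auto intro!: continuous_intros)
  then show ?case by (simp add: continuous_on_scaleR)
next
  case (Suc k)
  note d = Suc.prems[unfolded Ck.simps(2)]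
  have eq: "partial j (\<lambda>x. c *\<^sub>R f (a *\<^sub>R (x - z))) =
      (\<lambda>x. (c * a) *\<^sub>R partial j f (a *\<^sub>R (x - z)))" for j
    by (intro ext partial_affine(1)[where f = f and a = a and z = z and c = c]) (use d in blast)
  have "Ck k (\<lambda>x. (c * a) *\<^sub>R partial j f (a *\<^sub>R (x - z)))" for j
    by (rule Suc.IH[of "partial j f" "c * a"]) (use d in blast)
  moreover have "(\<lambda>x. c *\<^sub>R f (a *\<^sub>R (x - z))) differentiable (at x)" for x
    by (rule partial_affine(2)[where f = f and a = a and z = z and c = c]) (use d in blast)
  ultimately show ?case
    unfolding Ck.simps(2) eq by blast
qed

lemma Ck_scaleR_const:
  fixes f :: "vec3 \<Rightarrow> real"
  shows "Ck k f \<Longrightarrow> Ck k (\<lambda>x. f x *\<^sub>R v)"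
proof (induction k arbitrary: f)
  case 0
  then show ?case by (simp add: continuous_on_scaleR)
next
  case (Suc k)
  note d = Suc.prems[unfolded Ck.simps(2)]
  have eq: "partial j (\<lambda>x. f x *\<^sub>R v) = (\<lambda>x. partial j f x *\<^sub>R v)" for j
    by (intro ext partial_scaleR_const(1)[where f = f]) (use d in blast)
  have "Ck k (\<lambda>x. partial j f x *\<^sub>R v)" for j
    by (rule Suc.IH[of "partial j f"]) (use d in blast)
  moreover have "(\<lambda>x. f x *\<^sub>R v) differentiable (at x)" for x
    by (rule partial_scaleR_const(2)[where f = f]) (use d in blast)
  ultimately show ?case
    unfolding Ck.simps(2) eq by blast
qed

text \<open>Serves for partial derivatives and for squares: their smoothness is established
  separately, and neither operation enlarges the closed support.\<close>

lemma test_functions_restrict_support: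
  assumes f: "f \<in> test_functions \<Omega>" and Ck: "\<And>k. Ck k g"
    and sub: "{x. g x \<noteq> 0} \<subseteq> closure {x. f x \<noteq> 0}"
  shows "g \<in> test_functions \<Omega>"
proof -
  have *: "closure {x. g x \<noteq> 0} \<subseteq> closure {x. f x \<noteq> 0}"
    using sub by (intro closure_minimal) auto
  have f': "compact (closure {x. f x \<noteq> 0})" "closure {x. f x \<noteq> 0} \<subseteq> \<Omega>"
    using f by (simp_all add: test_functions_def)
  have "compact (closure {x. f x \<noteq> 0} \<inter> closure {x. g x \<noteq> 0})"
    by (intro compact_Int_closed f') auto
  with * have "compact (closure {x. g x \<noteq> 0})"
    by (simp add: Int_absorb1)
  then show ?thesis
    using * f' Ck by (simp add: test_functions_def)
qed

lemma test_functions_affine: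
  fixes f :: "vec3 \<Rightarrow> 'b::real_normed_vector"
  assumes f: "f \<in> test_functions (ball 0 \<rho>)" and a: "a > 0"
  shows "(\<lambda>x. f (a *\<^sub>R (x - z))) \<in> test_functions (ball z (\<rho> / a))"
proof -
  define K where "K = closure {x. f x \<noteq> 0}"
  have K: "compact K" "K \<subseteq> ball 0 \<rho>" using f by (auto simp: test_functions_def K_def)
  \<comment> \<open>The image of the support under the inverse of the affine map; it is compact and
    contains every point where the rescaled function is nonzero.\<close>
  define L where "L = (\<lambda>y. z + (1 / a) *\<^sub>R y) ` K"
  have "compact L"
    unfolding L_def by (intro compact_continuous_image K continuous_intros)
  have LK: "L \<subseteq> ball z (\<rho> / a)"
    using K a by (auto simp: L_def dist_norm field_simps subset_iff)
  have "{x. f (a *\<^sub>R (x - z)) \<noteq> 0} \<subseteq> L"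
  proof
    fix x assume "x \<in> {x. f (a *\<^sub>R (x - z)) \<noteq> 0}"
    then have "a *\<^sub>R (x - z) \<in> K" using closure_subset[of "{x. f x \<noteq> 0}"] by (auto simp: K_def)
    then show "x \<in> L" using a unfolding L_def by (intro image_eqI[where x = "a *\<^sub>R (x - z)"]) auto
  qed
  then have *: "closure {x. f (a *\<^sub>R (x - z)) \<noteq> 0} \<subseteq> L"
    using \<open>compact L\<close> by (intro closure_minimal compact_imp_closed)
  have "compact (L \<inter> closure {x. f (a *\<^sub>R (x - z)) \<noteq> 0})"
    using \<open>compact L\<close> by (intro compact_Int_closed) auto
  with * have "compact (closure {x. f (a *\<^sub>R (x - z)) \<noteq> 0})"
    by (simp add: Int_absorb1)
  moreover have "Ck k (\<lambda>x. f (a *\<^sub>R (x - z)))" for k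
    using Ck_affine[of k f 1 a z] f by (simp add: test_functions_def)
  ultimately show ?thesis
    using * LK by (auto simp: test_functions_def)
qed

lemma test_functions_Ck: "f \<in> test_functions \<Omega> \<Longrightarrow> Ck k f"
  by (simp add: test_functions_def)

lemma test_functions_mono: "\<Omega> \<subseteq> \<Omega>' \<Longrightarrow> test_functions \<Omega> \<subseteq> test_functions \<Omega>'"
  by (auto simp: test_functions_def)

lemma partial_eq_0_outside_support:
  assumes "x \<notin> closure {x. f x \<noteq> 0}"
  shows "partial j f x = 0"
proof -
  have "(f has_derivative (\<lambda>_. 0)) (at x)"
  proof (rule has_derivative_transform_within_open)
    show "((\<lambda>_. 0) has_derivative (\<lambda>_. 0)) (at x)" by simp
    show "x \<in> - closure {x. f x \<noteq> 0}" using assms by simp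
    show "0 = f y" if "y \<in> - closure {x. f x \<noteq> 0}" for y
      using that closure_subset[of "{x. f x \<noteq> 0}"] by auto
  qed auto
  from partial_eq_derivative[OF this] show ?thesis .
qed

lemma test_functions_partial:
  assumes "f \<in> test_functions \<Omega>"
  shows "partial j f \<in> test_functions \<Omega>"
proof (rule test_functions_restrict_support[OF assms])
  show "{x. partial j f x \<noteq> 0} \<subseteq> closure {x. f x \<noteq> 0}"
    using partial_eq_0_outside_support by blast
  show "Ck k (partial j f)" for k
    using test_functions_Ck[OF assms, of "Suc k"] by simp
qed

lemma test_functions_continuous: "f \<in> test_functions \<Omega> \<Longrightarrow> continuous_on UNIV f"
  using test_functions_Ck[of f \<Omega> 0] by simp

lemma test_functions_differentiable: "f \<in> test_functions \<Omega> \<Longrightarrow> f differentiable (at x)"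
  using test_functions_Ck[of f \<Omega> "Suc 0"] by simp

lemma test_functions_bounded:
  fixes f :: "vec3 \<Rightarrow> 'b::real_normed_vector"
  assumes "f \<in> test_functions \<Omega>"
  obtains B where "B \<ge> 0" "\<And>x. norm (f x) \<le> B"
proof -
  let ?K = "closure {x. f x \<noteq> 0}"
  have "compact ?K"
    using assms by (simp add: test_functions_def)
  then have "bounded (f ` ?K)"
    using continuous_on_subset[OF test_functions_continuous[OF assms] subset_UNIV]
    by (intro compact_imp_bounded compact_continuous_image)
  then obtain B where B: "\<And>x. x \<in> ?K \<Longrightarrow> norm (f x) \<le> B"
    unfolding bounded_iff by blast
  have "norm (f x) \<le> max B 0" for x
  proof (cases "f x = 0")
    case False
    then have "x \<in> ?K" using closure_subset[of "{x. f x \<noteq> 0}"] by blast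
    then show ?thesis using B[of x] by simp
  qed simp
  then show ?thesis using that[of "max B 0"] by simp
qed

text \<open>Compact support bounds each partial derivative. The sum of the three bounds controls the
  differential, and the mean value inequality makes it a Lipschitz constant. Having one
  \<open>L\<close> for increments and differentials gives the dominating factor \<open>2 * L\<close>
  for difference quotients under the integral.\<close>

lemma test_functions_lipschitz:
  fixes f :: "vec3 \<Rightarrow> real"
  assumes f: "f \<in> test_functions \<Omega>"
  obtains L where "L \<ge> 0" "\<And>x y. \<bar>f x - f y\<bar> \<le> L * norm (x - y)"
    "\<And>x h. \<bar>\<Sum>j\<in>UNIV. (h $ j) *\<^sub>R partial j f x\<bar> \<le> L * norm h"
proof -
  have "\<exists>B\<ge>0. \<forall>x. \<bar>partial j f x\<bar> \<le> B" for j
    by (rule test_functions_bounded[OF test_functions_partial[OF f, of j]]) auto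
  then have "\<exists>B. \<forall>j. B j \<ge> 0 \<and> (\<forall>x. \<bar>partial j f x\<bar> \<le> B j)"
    by (intro choice) blast
  then obtain B where B: "\<And>j. B j \<ge> 0" "\<And>j x. \<bar>partial j f x\<bar> \<le> B j"
    by blast
  have D: "norm (\<Sum>j\<in>UNIV. (h $ j) *\<^sub>R partial j f x) \<le> sum B UNIV * norm h" for x h
  proof -
    have "norm (\<Sum>j\<in>UNIV. (h $ j) *\<^sub>R partial j f x) \<le> (\<Sum>j\<in>UNIV. norm ((h $ j) *\<^sub>R partial j f x))"
      by (rule norm_sum)
    also have "\<dots> \<le> (\<Sum>j\<in>UNIV. B j * norm h)"
    proof (rule sum_mono)
      fix j
      have "\<bar>h $ j\<bar> * \<bar>partial j f x\<bar> \<le> norm h * B j"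
        by (intro mult_mono component_le_norm_cart B) auto
      then show "norm ((h $ j) *\<^sub>R partial j f x) \<le> B j * norm h"
        by (simp add: abs_mult mult.commute)
    qed
    finally show ?thesis
      by (simp add: sum_distrib_right)
  qed
  have nonneg: "0 \<le> sum B UNIV" by (simp add: B sum_nonneg)
  have "norm (f x - f y) \<le> sum B UNIV * norm (x - y)" for x y
    by (rule differentiable_bound[OF convex_UNIV has_derivative_partial[OF test_functions_differentiable[OF f]]
          onorm_bound[OF nonneg D]]) auto
  then show ?thesis
    using that[of "sum B UNIV"] nonneg D by simp
qed

section \<open>Mollification\<close>

lemma integrable_mult_bounded_continuous:
  fixes F g :: "vec3 \<Rightarrow> real"
  assumes F: "integrable lborel F" and g: "continuous_on UNIV g" and B: "\<And>x. \<bar>g x\<bar> \<le> B"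
  shows "integrable lborel (\<lambda>x. F x * g x)"
proof (rule Bochner_Integration.integrable_bound)
  show "integrable lborel (\<lambda>x. B * \<bar>F x\<bar>)"
    using F by (intro integrable_mult_right integrable_abs)
  show "(\<lambda>x. F x * g x) \<in> borel_measurable lborel"
    using borel_measurable_integrable[OF F] borel_measurable_continuous_onI[OF g]
    by (intro borel_measurable_times) auto
  show "AE x in lborel. norm (F x * g x) \<le> norm (B * \<bar>F x\<bar>)"
  proof (rule AE_I2)
    fix x
    have "\<bar>g x\<bar> * \<bar>F x\<bar> \<le> \<bar>B\<bar> * \<bar>F x\<bar>"
      by (intro mult_right_mono order_trans[OF B]) auto
    then show "norm (F x * g x) \<le> norm (B * \<bar>F x\<bar>)"
      by (simp add: abs_mult mult.commute)
  qed
qed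

lemma integrable_mult_test_function:
  fixes F w :: "vec3 \<Rightarrow> real"
  assumes F: "integrable lborel F" and w: "w \<in> test_functions \<Omega>"
  shows "integrable lborel (\<lambda>y. F y * w (y - x))"
proof -
  obtain B where "\<And>y. norm (w y) \<le> B"
    using test_functions_bounded[OF w] by blast
  then show ?thesis
    by (intro integrable_mult_bounded_continuous[OF F, where B = B]
        continuous_on_compose2[OF test_functions_continuous[OF w], where f = "\<lambda>y. y - x"] continuous_intros) auto
qed

text \<open>Differentiation under the integral sign by dominated convergence with majorant
  \<open>2 * L * \<bar>F y\<bar>\<close>. The derivative that comes out is a combination of the
  integrals in \<open>orth\<close>, which vanish.\<close>

lemma convolution_has_derivative_zero:
  fixes F w :: "vec3 \<Rightarrow> real"
  assumes F: "integrable lborel F" and w: "w \<in> test_functions \<Omega>"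
    and orth: "\<And>j. (\<integral>y. F y * partial j w (y - x) \<partial>lborel) = 0"
  shows "((\<lambda>x. \<integral>y. F y * w (y - x) \<partial>lborel) has_derivative (\<lambda>_. 0)) (at x)"
proof -
  obtain L where L: "L \<ge> 0" "\<And>x y. \<bar>w x - w y\<bar> \<le> L * norm (x - y)"
    "\<And>x h. \<bar>\<Sum>j\<in>UNIV. (h $ j) *\<^sub>R partial j w x\<bar> \<le> L * norm h"
    using test_functions_lipschitz[OF w] by blast
  define Dw where "Dw z h = (\<Sum>j\<in>UNIV. (h $ j) *\<^sub>R partial j w z)" for z h
  have Dw: "(w has_derivative Dw z) (at z)" for z
    unfolding Dw_def by (rule has_derivative_partial[OF test_functions_differentiable[OF w]])
  note int = integrable_mult_test_function[OF F w]
    and intp = integrable_mult_test_function[OF F test_functions_partial[OF w]]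
  have intD: "integrable lborel (\<lambda>y. F y * Dw (y - x) h)" for h
  proof -
    have "integrable lborel (\<lambda>y. \<Sum>j\<in>UNIV. (h $ j) * (F y * partial j w (y - x)))"
      by (intro Bochner_Integration.integrable_sum integrable_mult_right intp)
    then show ?thesis by (simp add: Dw_def sum_distrib_left algebra_simps)
  qed
  have zeroD: "(\<integral>y. F y * Dw (y - x) h \<partial>lborel) = 0" for h
  proof -
    have "(\<integral>y. F y * Dw (y - x) h \<partial>lborel) =
        (\<integral>y. (\<Sum>j\<in>UNIV. (h $ j) * (F y * partial j w (y - x))) \<partial>lborel)"
      by (simp add: Dw_def sum_distrib_left algebra_simps)
    also have "\<dots> = (\<Sum>j\<in>UNIV. (h $ j) * (\<integral>y. F y * partial j w (y - x) \<partial>lborel))"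
      by (subst Bochner_Integration.integral_sum) (simp_all add: integrable_mult_right intp)
    finally show ?thesis by (simp add: orth)
  qed
  \<comment> \<open>The remainder of the first-order expansion of w. The sign of \<open>Dw\<close>
    is positive because x enters the kernel as y - x, so an increment h of x is an increment -h of
    the argument. Since \<open>Dw\<close> integrates to zero against \<open>F\<close>, the integral
    of \<open>q h\<close> is exactly the difference quotient of the convolution.\<close>
  define q where "q h y = F y * ((w (y - (x + h)) - w (y - x) + Dw (y - x) h) / norm h)" for h y
  have q_int: "integrable lborel (q h)" for h
  proof -
    have "integrable lborel
        (\<lambda>y. (F y * w (y - (x + h)) - F y * w (y - x) + F y * Dw (y - x) h) / norm h)"
      by (intro integrable_divide Bochner_Integration.integrable_add
          Bochner_Integration.integrable_diff int intD)
    then show ?thesis by (simp add: q_def[abs_def] algebra_simps)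
  qed
  have q_eq: "(\<integral>y. q h y \<partial>lborel) =
      ((\<integral>y. F y * w (y - (x + h)) \<partial>lborel) - (\<integral>y. F y * w (y - x) \<partial>lborel)) / norm h" for h
  proof -
    have "(\<integral>y. q h y \<partial>lborel) =
        (\<integral>y. (F y * w (y - (x + h)) - F y * w (y - x) + F y * Dw (y - x) h) / norm h \<partial>lborel)"
      by (simp add: q_def algebra_simps)
    also have "\<dots> = ((\<integral>y. F y * w (y - (x + h)) \<partial>lborel) - (\<integral>y. F y * w (y - x) \<partial>lborel)
        + (\<integral>y. F y * Dw (y - x) h \<partial>lborel)) / norm h"
      by (simp add: int intD)
    finally show ?thesis by (simp add: zeroD)
  qed
  have "((\<lambda>h. \<integral>y. q h y \<partial>lborel) \<longlongrightarrow> 0) (at 0)"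
    unfolding tendsto_at_iff_sequentially o_def
  proof (intro allI impI)
    fix X :: "nat \<Rightarrow> vec3"
    assume "\<forall>i. X i \<in> UNIV - {0}" and X: "X \<longlonglongrightarrow> 0"
    then have X0: "X i \<noteq> 0" for i by auto
    have "(\<lambda>n. integral\<^sup>L lborel (q (X n))) \<longlonglongrightarrow> integral\<^sup>L lborel (\<lambda>y::vec3. 0::real)"
    proof (rule integral_dominated_convergence)
      show "integrable lborel (\<lambda>y. \<bar>F y\<bar> * (2 * L))"
        using F by (intro integrable_mult_left integrable_abs)
      show "q (X n) \<in> borel_measurable lborel" for n
        using q_int[of "X n"] by (rule borel_measurable_integrable)
      have bound: "\<bar>w (y - (x + h)) - w (y - x) + Dw (y - x) h\<bar> \<le> 2 * L * norm h" for y h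
      proof -
        have "\<bar>w (y - (x + h)) - w (y - x)\<bar> \<le> L * norm h"
          using L(2)[of "y - (x + h)" "y - x"] by simp
        then show ?thesis
          using L(3)[of h "y - x"] unfolding Dw_def by linarith
      qed
      show "AE y in lborel. (\<lambda>n. q (X n) y) \<longlonglongrightarrow> 0"
      proof (rule AE_I2)
        fix y
        \<comment> \<open>Differentiability of w at y - x, used along the null sequence
          \<open>- X n\<close>; oddness of \<open>Dw\<close> then restores the sign in q.\<close>
        have "((\<lambda>h. norm (w (y - x + h) - w (y - x) - Dw (y - x) h) / norm h) \<longlongrightarrow> 0) (at 0)"
          using Dw[of "y - x"] by (simp add: has_derivative_at)
        moreover have "filterlim (\<lambda>n. - X n) (at 0) sequentially"
          using tendsto_minus[OF X] X0 by (simp add: filterlim_at)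
        ultimately have "(\<lambda>n. norm (w (y - x + - X n) - w (y - x) - Dw (y - x) (- X n)) / norm (- X n))
            \<longlonglongrightarrow> 0"
          by (rule filterlim_compose)
        moreover have "Dw (y - x) (- h) = - Dw (y - x) h" for h
          by (simp add: Dw_def sum_negf)
        ultimately have "(\<lambda>n. \<bar>(w (y - (x + X n)) - w (y - x) + Dw (y - x) (X n)) / norm (X n)\<bar>)
            \<longlonglongrightarrow> 0"
          by (simp add: algebra_simps)
        then have "(\<lambda>n. (w (y - (x + X n)) - w (y - x) + Dw (y - x) (X n)) / norm (X n)) \<longlonglongrightarrow> 0"
          by (rule tendsto_rabs_zero_cancel)
        from tendsto_mult_right_zero[OF this, of "F y"] show "(\<lambda>n. q (X n) y) \<longlonglongrightarrow> 0"
          by (simp add: q_def)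
      qed
      show "AE y in lborel. norm (q (X n) y) \<le> \<bar>F y\<bar> * (2 * L)" for n
      proof (rule AE_I2)
        fix y
        have "\<bar>w (y - (x + X n)) - w (y - x) + Dw (y - x) (X n)\<bar> / norm (X n) \<le> 2 * L"
          using bound[of y "X n"] X0[of n] by (simp add: divide_le_eq)
        then have "\<bar>F y\<bar> * (\<bar>w (y - (x + X n)) - w (y - x) + Dw (y - x) (X n)\<bar> / norm (X n)) \<le> \<bar>F y\<bar> * (2 * L)"
          by (rule mult_left_mono) simp
        then show "norm (q (X n) y) \<le> \<bar>F y\<bar> * (2 * L)"
          by (simp add: q_def abs_mult)
      qed
    qed simp
    then show "(\<lambda>i. \<integral>y. q (X i) y \<partial>lborel) \<longlonglongrightarrow> 0" by simp
  qed
  from tendsto_rabs_zero[OF this] show ?thesis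
    by (simp add: has_derivative_at q_eq)
qed

lemma convolution_constant:
  fixes F w :: "vec3 \<Rightarrow> real"
  assumes F: "integrable lborel F" and w: "w \<in> test_functions \<Omega>" and S: "convex S" "open S"
    and orth: "\<And>x j. x \<in> S \<Longrightarrow> (\<integral>y. F y * partial j w (y - x) \<partial>lborel) = 0"
  shows "\<exists>C. \<forall>x\<in>S. (\<integral>y. F y * w (y - x) \<partial>lborel) = C"
proof -
  have "((\<lambda>x. \<integral>y. F y * w (y - x) \<partial>lborel) has_derivative (\<lambda>_. 0)) (at x within S)" if "x \<in> S" for x
    using convolution_has_derivative_zero[OF F w orth[OF that]] by (rule has_derivative_at_withinI)
  from has_derivative_zero_constant[OF S(1) this] show ?thesis by blast
qed

lemma lborel_distr_reflect:
  fixes y :: "'a::euclidean_space"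
  shows "distr lborel borel (\<lambda>x. y - x) = lborel"
  using lborel_affine[of "-1" y] by (simp add: density_1)

text \<open>The kernel w (y - x) is integrated in y against \<open>F\<close> but in x against a
  bump; the second use requires the reflected variable.\<close>

lemma
  fixes w :: "vec3 \<Rightarrow> real"
  assumes "w \<in> test_functions \<Omega>"
  shows test_functions_integrable: "integrable lborel w"
    and test_functions_integrable_reflect: "integrable lborel (\<lambda>x. w (y - x))"
    and test_functions_integral_reflect: "(\<integral>x. w (y - x) \<partial>lborel) = (\<integral>x. w x \<partial>lborel)"
proof -
  let ?K = "closure {x. w x \<noteq> 0}"
  have w: "continuous_on UNIV w" using assms by (rule test_functions_continuous)
  have "integrable lborel (\<lambda>x. indicator ?K x *\<^sub>R w x)"
    using assms by (intro borel_integrable_compact continuous_on_subset[OF w]) (auto simp: test_functions_def)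
  moreover have "(\<lambda>x. indicator ?K x *\<^sub>R w x) = w"
  proof
    show "indicator ?K x *\<^sub>R w x = w x" for x
      using closure_subset[of "{x. w x \<noteq> 0}"] by (cases "w x = 0") auto
  qed
  ultimately show int: "integrable lborel w" by simp
  have meas: "w \<in> borel_measurable borel" "(\<lambda>x. y - x) \<in> lborel \<rightarrow>\<^sub>M borel"
    using borel_measurable_continuous_onI[OF w] by simp_all
  show "integrable lborel (\<lambda>x. w (y - x))"
    using int integrable_distr_eq[OF meas(2,1)] by (simp add: lborel_distr_reflect)
  show "(\<integral>x. w (y - x) \<partial>lborel) = (\<integral>x. w x \<partial>lborel)"
    using integral_distr[OF meas(2,1)] by (simp add: lborel_distr_reflect)
qed

section \<open>Averages against nonnegative kernels\<close>

lemma integral_pos: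
  fixes g :: "vec3 \<Rightarrow> real"
  assumes g: "integrable lborel g" "\<And>x. g x \<ge> 0" and pos: "\<And>x. x \<in> ball z e \<Longrightarrow> g x > 0" "e > 0"
  shows "(\<integral>x. g x \<partial>lborel) > 0"
proof -
  have "(\<integral>x. g x \<partial>lborel) \<noteq> 0"
  proof
    assume "(\<integral>x. g x \<partial>lborel) = 0"
    then have "AE x in lborel. g x = 0"
      using integral_nonneg_eq_0_iff_AE[OF g(1)] g(2) by simp
    then have "AE x in lborel. x \<notin> ball z e"
      by eventually_elim (use pos(1) in force)
    then have "emeasure lborel (ball z e) = 0"
      by (subst (asm) AE_iff_measurable[of "ball z e"]) auto
    then have "negligible (ball z e)"
      by (simp add: negligible_iff_null_sets null_sets_def)
    with open_not_negligible[of "ball z e"] pos(2) show False by auto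
  qed
  moreover have "(\<integral>x. g x \<partial>lborel) \<ge> 0" using g(2) by simp
  ultimately show ?thesis by simp
qed

text \<open>The quotient is a weighted mean of values of c at points closer to y than \<rho>, so it
  differs from c y by at most the oscillation e there.\<close>

lemma mollification_close:
  fixes c w :: "vec3 \<Rightarrow> real"
  assumes w: "w \<in> test_functions (ball 0 \<rho>)" "\<And>z. w z \<ge> 0" and N: "(\<integral>z. w z \<partial>lborel) > 0"
    and c: "integrable lborel c"
    and e: "\<And>x. dist x y < \<rho> \<Longrightarrow> \<bar>c x - c y\<bar> \<le> e"
  shows "\<bar>(\<integral>x. c x * w (y - x) \<partial>lborel) / (\<integral>z. w z \<partial>lborel) - c y\<bar> \<le> e"
proof -
  let ?N = "\<integral>z. w z \<partial>lborel"
  obtain B where B: "\<And>z. norm (w z) \<le> B"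
    using test_functions_bounded[OF w(1)] by blast
  note wi = test_functions_integrable_reflect[OF w(1), of y]
  have ci: "integrable lborel (\<lambda>x. c x * w (y - x))"
    using B by (intro integrable_mult_bounded_continuous[OF c, where B = B]
        continuous_on_compose2[OF test_functions_continuous[OF w(1)], where f = "\<lambda>x. y - x"] continuous_intros) auto
  have "(\<integral>x. c x * w (y - x) \<partial>lborel) - c y * ?N = (\<integral>x. (c x - c y) * w (y - x) \<partial>lborel)"
    using wi ci by (simp add: left_diff_distrib test_functions_integral_reflect[OF w(1)])
  also have "\<bar>\<dots>\<bar> \<le> (\<integral>x. e * w (y - x) \<partial>lborel)"
  proof (rule order_trans[OF integral_abs_bound], rule integral_mono)
    show "integrable lborel (\<lambda>x. \<bar>(c x - c y) * w (y - x)\<bar>)"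
      using wi ci by (intro integrable_abs) (simp add: left_diff_distrib)
    show "integrable lborel (\<lambda>x. e * w (y - x))" using wi by simp
    fix x
    show "\<bar>(c x - c y) * w (y - x)\<bar> \<le> e * w (y - x)"
    proof (cases "w (y - x) = 0")
      case False
      then have "y - x \<in> ball 0 \<rho>"
        using w(1) closure_subset[of "{z. w z \<noteq> 0}"] unfolding test_functions_def by blast
      then have "dist x y < \<rho>" by (simp add: dist_norm norm_minus_commute)
      from mult_right_mono[OF e[OF this] w(2)[of "y - x"]] show ?thesis
        using w(2) by (simp add: abs_mult)
    qed simp
  qed
  also have "\<dots> = e * ?N"
    by (simp add: test_functions_integral_reflect[OF w(1)])
  finally have "\<bar>(\<integral>x. c x * w (y - x) \<partial>lborel) - c y * ?N\<bar> \<le> e * ?N" .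
  moreover have "(\<integral>x. c x * w (y - x) \<partial>lborel) / ?N - c y = ((\<integral>x. c x * w (y - x) \<partial>lborel) - c y * ?N) / ?N"
    using N by (simp add: field_simps)
  ultimately show ?thesis
    using N by (simp add: abs_divide divide_le_eq)
qed

text \<open>Moves the smoothing from \<open>F\<close> to c. Joint integrability comes from the
  product of the two integrable functions, w being bounded.\<close>

lemma Fubini_mollification:
  fixes F c w :: "vec3 \<Rightarrow> real"
  assumes F: "integrable lborel F" and c: "integrable lborel c" and w: "w \<in> test_functions \<Omega>"
  shows "(\<integral>x. c x * (\<integral>y. F y * w (y - x) \<partial>lborel) \<partial>lborel) =
         (\<integral>y. F y * (\<integral>x. c x * w (y - x) \<partial>lborel) \<partial>lborel)"
proof -
  obtain B where B: "B \<ge> 0" "\<And>z. norm (w z) \<le> B"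
    using test_functions_bounded[OF w] by blast
  have [measurable]: "F \<in> borel_measurable borel" "c \<in> borel_measurable borel" "w \<in> borel_measurable borel"
    using borel_measurable_integrable[OF F] borel_measurable_integrable[OF c]
      borel_measurable_continuous_onI[OF test_functions_continuous[OF w]] by simp_all
  have "integrable (lborel \<Otimes>\<^sub>M lborel) (\<lambda>(x, y). c x * F y)"
  proof (rule lborel_pair.Fubini_integrable)
    have "integrable lborel (\<lambda>x. \<bar>c x\<bar> * (\<integral>y. \<bar>F y\<bar> \<partial>lborel))"
      by (intro integrable_mult_left integrable_abs c)
    then show "integrable lborel (\<lambda>x. \<integral>y. norm (case (x, y) of (x, y) \<Rightarrow> c x * F y) \<partial>lborel)"
      by (simp add: abs_mult)
    show "AE x in lborel. integrable lborel (\<lambda>y. case (x, y) of (x, y) \<Rightarrow> c x * F y)"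
      using F by simp
  qed measurable
  then have "integrable (lborel \<Otimes>\<^sub>M lborel) (\<lambda>p. B * (case p of (x, y) \<Rightarrow> c x * F y))"
    by (rule integrable_mult_right)
  then have int: "integrable (lborel \<Otimes>\<^sub>M lborel) (\<lambda>(x, y). c x * (F y * w (y - x)))"
  proof (rule Bochner_Integration.integrable_bound)
    show "(\<lambda>(x, y). c x * (F y * w (y - x))) \<in> borel_measurable (lborel \<Otimes>\<^sub>M lborel)"
      by measurable
    have "\<bar>c x * (F y * w (y - x))\<bar> \<le> \<bar>B * (c x * F y)\<bar>" for x y
      using mult_left_mono[OF B(2)[of "y - x"], of "\<bar>c x * F y\<bar>"] B(1)
      by (simp add: abs_mult mult_ac)
    then show "AE p in lborel \<Otimes>\<^sub>M lborel. norm (case p of (x, y) \<Rightarrow> c x * (F y * w (y - x)))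
        \<le> norm (B * (case p of (x, y) \<Rightarrow> c x * F y))"
      by (intro AE_I2) auto
  qed
  have "(\<integral>x. c x * (\<integral>y. F y * w (y - x) \<partial>lborel) \<partial>lborel) =
      (\<integral>x. (\<integral>y. c x * (F y * w (y - x)) \<partial>lborel) \<partial>lborel)"
    by simp
  also have "\<dots> = (\<integral>y. (\<integral>x. c x * (F y * w (y - x)) \<partial>lborel) \<partial>lborel)"
    by (rule lborel_pair.Fubini_integral[OF int, symmetric])
  also have "\<dots> = (\<integral>y. F y * (\<integral>x. c x * w (y - x) \<partial>lborel) \<partial>lborel)"
    by (simp add: mult.left_commute[of "c _" "F _"])
  finally show ?thesis .
qed

section \<open>Functions with vanishing weak gradient\<close>

text \<open>The open sets are stable under intersection and generate the Borel sets. The property of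
  having integral zero passes to complements, since the whole space is open, and to countable
  disjoint unions, so it holds for all Borel sets. Then \<open>H\<close> and 0 are densities of the
  same set function.\<close>

lemma AE_zero_if_open_integrals_zero:
  fixes H :: "'a::euclidean_space \<Rightarrow> real"
  assumes H: "integrable lborel H" and zero: "\<And>U. open U \<Longrightarrow> (LINT x:U|lborel. H x) = 0"
  shows "AE x in lborel. H x = 0"
proof (rule density_unique_real)
  have sI: "set_integrable lborel A H" if "A \<in> sets borel" for A
    using integrable_mult_indicator[OF _ H, of A] that by (simp add: set_integrable_def)
  fix A :: "'a set" assume "A \<in> sets lborel"
  then have "Int_stable {S::'a set. open S}" "{S::'a set. open S} \<subseteq> Pow UNIV"
    "A \<in> sigma_sets UNIV {S. open S}"
    by (auto simp: borel_def Int_stable_def)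
  then have "(LINT x:A|lborel. H x) = 0"
  proof (induction rule: sigma_sets_induct_disjoint)
    case (compl A)
    then have A: "A \<in> sets borel" by (simp add: borel_def)
    have "(LINT x:UNIV|lborel. H x) = (LINT x:A|lborel. H x) + (LINT x:UNIV - A|lborel. H x)"
      using set_integral_Un[of A "UNIV - A" lborel H] sI[OF A] sI[of "UNIV - A"] A by simp
    then show ?case using compl zero[of UNIV] by simp
  next
    case (union A)
    then have A: "A i \<in> sets borel" for i by (auto simp: borel_def)
    have "(LINT x:(\<Union>i. A i)|lborel. H x) = (\<Sum>i. (LINT x:(A i)|lborel. H x))"
      using union(1) A by (intro lebesgue_integral_countable_add sI) (auto simp: disjoint_family_on_def)
    then show ?case using union by simp
  qed (auto simp: Int_stable_def zero)
  then show "(LINT x:A|lborel. H x) = (LINT x:A|lborel. 0)" by simp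
qed (use H in auto)

text \<open>A continuous approximation from below to the indicator of an open set. Continuity
  suffices for these weights, as derivatives fall only on the mollifier.\<close>

definition ramp :: "nat \<Rightarrow> 'a::metric_space set \<Rightarrow> 'a \<Rightarrow> real" where
  "ramp n U x = min 1 (real n * infdist x (- U))"

lemma ramp_continuous: "continuous_on UNIV (ramp n U)"
  unfolding ramp_def[abs_def] by (intro continuous_intros)

lemma ramp_bounds: "0 \<le> ramp n U x" "ramp n U x \<le> 1"
  by (simp_all add: ramp_def infdist_nonneg)

lemma ramp_outside: "x \<notin> U \<Longrightarrow> ramp n U x = 0"
  by (simp add: ramp_def)

text \<open>\<open>U \<noteq> UNIV\<close> excludes the convention that the distance to the empty
  set is 0, under which the ramp of the whole space is identically zero.\<close>

lemma ramp_pos: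
  assumes "open U" "U \<noteq> UNIV" "x \<in> U" "n > 0"
  shows "ramp n U x > 0"
proof -
  have "infdist x (- U) > 0"
    using assms by (intro infdist_pos_not_in_closed) auto
  then show ?thesis
    using assms by (simp add: ramp_def)
qed

lemma ramp_tendsto:
  assumes "open U" "U \<noteq> UNIV"
  shows "(\<lambda>n. ramp n U x) \<longlonglongrightarrow> indicator U x"
proof (cases "x \<in> U")
  case True
  then have pos: "infdist x (- U) > 0"
    using infdist_pos_not_in_closed[of "- U" x] assms by auto
  then obtain m where m: "1 < real m * infdist x (- U)"
    using reals_Archimedean3 by blast
  have "ramp n U x = 1" if "n \<ge> m" for n
  proof -
    have "real m * infdist x (- U) \<le> real n * infdist x (- U)"
      using that pos by (intro mult_right_mono) auto
    then show ?thesis using m by (simp add: ramp_def)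
  qed
  then have "(\<lambda>n. ramp n U x) \<longlonglongrightarrow> 1"
    by (intro tendsto_eventually eventually_sequentiallyI[of m])
  then show ?thesis using True by simp
qed (simp add: ramp_outside)

lemma ramp_integrable:
  fixes U :: "vec3 set"
  assumes "bounded U"
  shows "integrable lborel (ramp n U)"
proof -
  have "integrable lborel (\<lambda>x. indicator (closure U) x *\<^sub>R ramp n U x)"
    by (intro borel_integrable_compact continuous_on_subset[OF ramp_continuous])
      (use assms in auto)
  moreover have "(\<lambda>x. indicator (closure U) x *\<^sub>R ramp n U x) = ramp n U"
  proof
    show "indicator (closure U) x *\<^sub>R ramp n U x = ramp n U x" for x
      using closure_subset[of U] by (cases "x \<in> U") (auto simp: ramp_outside)
  qed
  ultimately show ?thesis by simp
qed

text \<open>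
  The cutoff serves as a smooth bump function; squaring makes it nonnegative, so that its integral
  cannot vanish.
\<close>

lemma cutoff_mollifier:
  assumes "cutoff \<phi>" "a > 0"
  defines "w \<equiv> \<lambda>z. (\<phi> (a *\<^sub>R z))\<^sup>2"
  shows "w \<in> test_functions (ball 0 (2 / a))" "w z \<ge> 0" "(\<integral>z. w z \<partial>lborel) > 0"
proof -
  have \<phi>: "\<phi> \<in> test_functions (ball 0 2)" "\<And>x. x \<in> ball 0 1 \<Longrightarrow> \<phi> x = 1"
    using assms(1) by (auto simp: cutoff_def)
  have \<phi>a: "(\<lambda>z. \<phi> (a *\<^sub>R z)) \<in> test_functions (ball 0 (2 / a))"
    using test_functions_affine[OF \<phi>(1) assms(2), of 0] by simp
  show w: "w \<in> test_functions (ball 0 (2 / a))"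
  proof (rule test_functions_restrict_support[OF \<phi>a])
    show "Ck k w" for k
      unfolding w_def power2_eq_square by (intro Ck_mult test_functions_Ck[OF \<phi>a])
    show "{x. w x \<noteq> 0} \<subseteq> closure {x. \<phi> (a *\<^sub>R x) \<noteq> 0}"
      using closure_subset[of "{x. \<phi> (a *\<^sub>R x) \<noteq> 0}"] by (auto simp: w_def)
  qed
  show "w z \<ge> 0" for z by (simp add: w_def)
  show "(\<integral>z. w z \<partial>lborel) > 0"
  proof (rule integral_pos[OF test_functions_integrable[OF w]])
    show "w z \<ge> 0" for z by (simp add: w_def)
    show "1 / a > 0" using assms(2) by simp
    show "w z > 0" if "z \<in> ball 0 (1 / a)" for z
    proof -
      have "a *\<^sub>R z \<in> ball 0 1" using that assms(2) by (simp add: field_simps)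
      then show ?thesis using \<phi>(2) by (simp add: w_def)
    qed
  qed
qed

lemma tendsto_mollification:
  fixes c :: "vec3 \<Rightarrow> real" and w :: "nat \<Rightarrow> vec3 \<Rightarrow> real"
  assumes w: "\<And>n. w n \<in> test_functions (ball 0 (\<rho> n))" "\<And>n z. w n z \<ge> 0"
    "\<And>n. (\<integral>z. w n z \<partial>lborel) > 0" and \<rho>: "\<rho> \<longlonglongrightarrow> 0"
    and c: "integrable lborel c" "continuous_on UNIV c"
  shows "(\<lambda>n. (\<integral>x. c x * w n (y - x) \<partial>lborel) / (\<integral>z. w n z \<partial>lborel)) \<longlonglongrightarrow> c y"
proof (rule LIMSEQ_I)
  fix e :: real assume "e > 0"
  then have "isCont c y" using c(2) by (simp add: continuous_on_eq_continuous_at)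
  then obtain d where d: "d > 0" "\<And>x. dist x y < d \<Longrightarrow> dist (c x) (c y) < e / 2"
    using \<open>e > 0\<close> unfolding continuous_at_eps_delta by (meson half_gt_zero)
  from LIMSEQ_D[OF \<rho> d(1)] obtain n0 where n0: "\<And>n. n \<ge> n0 \<Longrightarrow> \<rho> n < d"
    by fastforce
  show "\<exists>n0. \<forall>n\<ge>n0. norm ((\<integral>x. c x * w n (y - x) \<partial>lborel) / (\<integral>z. w n z \<partial>lborel) - c y) < e"
  proof (intro exI allI impI)
    fix n assume n: "n \<ge> n0"
    have "\<bar>(\<integral>x. c x * w n (y - x) \<partial>lborel) / (\<integral>z. w n z \<partial>lborel) - c y\<bar> \<le> e / 2"
    proof (rule mollification_close[OF w(1,2,3) c(1)])
      fix x assume "dist x y < \<rho> n"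
      then have "dist (c x) (c y) < e / 2"
        using d(2)[of x] n0[OF n] by linarith
      then show "\<bar>c x - c y\<bar> \<le> e / 2" by (simp add: dist_real_def)
    qed
    then show "norm ((\<integral>x. c x * w n (y - x) \<partial>lborel) / (\<integral>z. w n z \<partial>lborel) - c y) < e"
      using \<open>e > 0\<close> by simp
  qed
qed

text \<open>
  The convolutions of \<open>F\<close> with the mollifiers are constant on the ball.  By Fubini, the mean of \<open>F\<close>
  weighted by a continuous bump function is the limit of these constants, whatever the bump function.
\<close>

lemma weak_gradient_zero_ball_lborel:
  fixes F :: "vec3 \<Rightarrow> real"
  assumes \<phi>: "cutoff \<phi>" and F: "integrable lborel F" and r: "r > 0"
    and orth: "\<And>\<psi> j. \<psi> \<in> test_functions (ball x0 (2 * r)) \<Longrightarrow>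
      (\<integral>y. F y * partial j \<psi> y \<partial>lborel) = 0"
  shows "\<exists>m. AE x in lborel. x \<in> ball x0 r \<longrightarrow> F x = m"
proof -
  define B where "B = ball x0 r"
  have B: "open B" "bounded B" "convex B" "B \<noteq> UNIV" "B \<noteq> {}"
    using r by (auto simp: B_def dest: arg_cong[where f = bounded])
  \<comment> \<open>The summand 2 / r keeps the kernel radius 2 / a n at most r already for n = 0,
    so a kernel centred in \<open>B\<close> is supported in the ball of radius 2 * r, where
    \<open>orth\<close> applies; the summand n makes the radii tend to 0.\<close>
  define a where "a n = real n + 2 / r" for n
  have a: "a n > 0" for n using r by (simp add: a_def add_nonneg_pos)
  have ar: "2 / a n \<le> r" for n using r a[of n] by (simp add: a_def field_simps)
  have a0: "(\<lambda>n. 2 / a n) \<longlonglongrightarrow> 0"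
    unfolding a_def
    by (intro tendsto_divide_0[OF tendsto_const] filterlim_at_top_imp_at_infinity
        filterlim_tendsto_add_at_top[OF tendsto_const filterlim_real_sequentially, of "2 / r", simplified add.commute])
  define w where "w n z = (\<phi> (a n *\<^sub>R z))\<^sup>2" for n z
  have w: "w n \<in> test_functions (ball 0 (2 / a n))" "w n z \<ge> 0" "(\<integral>z. w n z \<partial>lborel) > 0" for n z
    using cutoff_mollifier[OF \<phi> a[of n]] unfolding w_def[abs_def] by auto
  have "\<exists>C. \<forall>x\<in>B. (\<integral>y. F y * w n (y - x) \<partial>lborel) = C" for n
  proof (rule convolution_constant[OF F w(1) B(3,1)])
    fix x j assume "x \<in> B"
    then have "ball x (2 / a n) \<subseteq> ball x0 (2 * r)"
    proof (intro subsetI)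
      fix y assume "y \<in> ball x (2 / a n)"
      then show "y \<in> ball x0 (2 * r)"
        using ar[of n] \<open>x \<in> B\<close> dist_triangle[of x0 y x] by (simp add: B_def)
    qed
    moreover have "(\<lambda>y. w n (y - x)) \<in> test_functions (ball x (2 / a n))"
      using test_functions_affine[OF w(1)[of n], of 1 x] by simp
    ultimately have "(\<lambda>y. w n (y - x)) \<in> test_functions (ball x0 (2 * r))"
      using test_functions_mono by blast
    moreover have "partial j (\<lambda>y. w n (y - x)) y = partial j (w n) (y - x)" for y
      using partial_affine(1)[of "w n" 1 y x j 1] test_functions_differentiable[OF w(1)] by simp
    ultimately show "(\<integral>y. F y * partial j (w n) (y - x) \<partial>lborel) = 0"
      using orth[of "\<lambda>y. w n (y - x)" j] by simp
  qed
  then obtain C where C: "\<And>n x. x \<in> B \<Longrightarrow> (\<integral>y. F y * w n (y - x) \<partial>lborel) = C n"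
    by metis
  define N where "N n = (\<integral>z. w n z \<partial>lborel)" for n
  \<comment> \<open>As c lives on \<open>B\<close>, pairing it with the mollified \<open>F\<close>
    only sees the constant \<open>C n\<close>. By Fubini the same number pairs \<open>F\<close> with
    the mollified c, which is bounded by 1 and converges pointwise to c.\<close>
  have lim: "(\<lambda>n. C n / N n * (\<integral>x. c x \<partial>lborel)) \<longlonglongrightarrow> (\<integral>y. F y * c y \<partial>lborel)"
    if c: "integrable lborel c" "continuous_on UNIV c" "\<And>x. 0 \<le> c x" "\<And>x. c x \<le> 1"
      "\<And>x. x \<notin> B \<Longrightarrow> c x = 0" for c :: "vec3 \<Rightarrow> real"
  proof -
    define M where "M n y = (\<integral>x. c x * w n (y - x) \<partial>lborel) / N n" for n y
    have "(\<integral>x. c x * (\<integral>y. F y * w n (y - x) \<partial>lborel) \<partial>lborel) = C n * (\<integral>x. c x \<partial>lborel)" for n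
    proof -
      have "(\<lambda>x. c x * (\<integral>y. F y * w n (y - x) \<partial>lborel)) = (\<lambda>x. C n * c x)"
      proof
        show "c x * (\<integral>y. F y * w n (y - x) \<partial>lborel) = C n * c x" for x
          using C[of x n] c(5)[of x] by (cases "x \<in> B") auto
      qed
      then show ?thesis by simp
    qed
    then have eq: "C n / N n * (\<integral>x. c x \<partial>lborel) = (\<integral>y. F y * M n y \<partial>lborel)" for n
      using Fubini_mollification[OF F c(1) w(1)[of n]] by (simp add: M_def)
    have [measurable]: "F \<in> borel_measurable borel" "c \<in> borel_measurable borel"
      "w n \<in> borel_measurable borel" for n
      using borel_measurable_integrable[OF F] borel_measurable_integrable[OF c(1)]
        borel_measurable_continuous_onI[OF test_functions_continuous[OF w(1)]] by simp_all
    have "(\<lambda>n. \<integral>y. F y * M n y \<partial>lborel) \<longlonglongrightarrow> (\<integral>y. F y * c y \<partial>lborel)"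
    proof (rule integral_dominated_convergence)
      show "integrable lborel (\<lambda>y. \<bar>F y\<bar>)" using F by simp
      show "AE y in lborel. (\<lambda>n. F y * M n y) \<longlonglongrightarrow> F y * c y"
        unfolding M_def N_def
        by (intro AE_I2 tendsto_mult tendsto_const tendsto_mollification[OF w a0 c(1,2)])
      show "AE y in lborel. norm (F y * M n y) \<le> \<bar>F y\<bar>" for n
      proof (rule AE_I2)
        fix y
        have "0 \<le> (\<integral>x. c x * w n (y - x) \<partial>lborel)"
          using c(3) w(2) by (intro Bochner_Integration.integral_nonneg) simp
        moreover have "(\<integral>x. c x * w n (y - x) \<partial>lborel) \<le> (\<integral>x. w n (y - x) \<partial>lborel)"
        proof (rule integral_mono)
          have "\<bar>c x\<bar> \<le> 1" for x using c(3,4)[of x] by simp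
          then show "integrable lborel (\<lambda>x. c x * w n (y - x))"
            using integrable_mult_bounded_continuous[OF test_functions_integrable_reflect[OF w(1)] c(2), of 1 n y]
            by (simp add: mult.commute)
          show "c x * w n (y - x) \<le> w n (y - x)" for x
            using mult_right_mono[OF c(4)[of x] w(2)] by simp
        qed (rule test_functions_integrable_reflect[OF w(1)])
        ultimately have "\<bar>M n y\<bar> \<le> 1"
          using w(3)[of n] by (simp add: M_def N_def test_functions_integral_reflect[OF w(1)])
        from mult_left_mono[OF this, of "\<bar>F y\<bar>"] show "norm (F y * M n y) \<le> \<bar>F y\<bar>"
          by (simp add: abs_mult)
      qed
      show "(\<lambda>y. F y * M n y) \<in> borel_measurable lborel" for n
        unfolding M_def by measurable
      show "(\<lambda>y. F y * c y) \<in> borel_measurable lborel" by measurable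
    qed
    then show ?thesis unfolding eq .
  qed
  note ramp = ramp_integrable ramp_continuous ramp_bounds
  \<comment> \<open>One fixed bump with positive integral turns the limit relation into convergence
    of the normalised constants \<open>C n / N n\<close>. The index 1 is the first for which the
    ramp is positive on \<open>B\<close>.\<close>
  define I where "I = (\<integral>x. ramp 1 B x \<partial>lborel)"
  have "I > 0"
    unfolding I_def
    by (rule integral_pos[OF ramp(1)[OF B(2)] ramp(3), of x0 r])
      (use ramp_pos[OF B(1,4), of _ 1] r in \<open>auto simp: B_def\<close>)
  define m where "m = (\<integral>y. F y * ramp 1 B y \<partial>lborel) / I"
  have Cm: "(\<lambda>n. C n / N n) \<longlonglongrightarrow> m"
  proof -
    have "(\<lambda>n. C n / N n * I) \<longlonglongrightarrow> (\<integral>y. F y * ramp 1 B y \<partial>lborel)"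
      unfolding I_def by (rule lim[OF ramp(1)[OF B(2)] ramp(2,3,4) ramp_outside])
    from tendsto_divide[OF this tendsto_const[of I]] \<open>I > 0\<close> show ?thesis
      by (simp add: m_def)
  qed
  define H where "H x = indicator B x * (F x - m)" for x
  have H: "integrable lborel H"
  proof -
    have Bm: "B \<in> sets lborel" using B(1) by simp
    have "integrable lborel (indicator B :: vec3 \<Rightarrow> real)"
      using emeasure_bounded_finite[OF B(2)] by (intro integrable_real_indicator Bm) simp
    then have "integrable lborel (\<lambda>x. indicator B x *\<^sub>R F x - m * indicator B x)"
      by (intro Bochner_Integration.integrable_diff integrable_mult_indicator[OF Bm F] integrable_mult_right)
    then show ?thesis by (simp add: H_def[abs_def] algebra_simps)
  qed
  have "(LINT x:U|lborel. H x) = 0" if "open U" for U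
  proof -
    \<comment> \<open>The intersection gives ramps supported in \<open>B\<close>, where the limit
      relation is available, and it is never the whole space. Nothing is lost because
      \<open>H\<close> vanishes off \<open>B\<close>.\<close>
    define V where "V = U \<inter> B"
    have V: "open V" "bounded V" "V \<noteq> UNIV"
      using that B by (auto simp: V_def dest: bounded_subset)
    have zero: "(\<integral>x. H x * ramp n V x \<partial>lborel) = 0" for n
    proof -
      have "(\<lambda>k. C k / N k * (\<integral>x. ramp n V x \<partial>lborel)) \<longlonglongrightarrow> (\<integral>y. F y * ramp n V y \<partial>lborel)"
        by (rule lim[OF ramp(1)[OF V(2)] ramp(2,3,4) ramp_outside]) (auto simp: V_def)
      moreover have "(\<lambda>k. C k / N k * (\<integral>x. ramp n V x \<partial>lborel)) \<longlonglongrightarrow> m * (\<integral>x. ramp n V x \<partial>lborel)"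
        by (intro tendsto_mult Cm tendsto_const)
      ultimately have eq: "(\<integral>y. F y * ramp n V y \<partial>lborel) = m * (\<integral>x. ramp n V x \<partial>lborel)"
        by (rule LIMSEQ_unique)
      have "H x * ramp n V x = F x * ramp n V x - m * ramp n V x" for x
        by (cases "x \<in> V") (auto simp: H_def ramp_outside V_def algebra_simps)
      moreover have "integrable lborel (\<lambda>x. F x * ramp n V x)"
        by (rule integrable_mult_bounded_continuous[OF F ramp(2), where B = 1]) (simp add: ramp_bounds abs_le_iff add_increasing)
      ultimately show ?thesis
        using eq ramp(1)[OF V(2)] by simp
    qed
    have "(\<lambda>n. \<integral>x. H x * ramp n V x \<partial>lborel) \<longlonglongrightarrow> (\<integral>x. H x * indicator V x \<partial>lborel)"
    proof (rule integral_dominated_convergence)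
      show "integrable lborel (\<lambda>x. \<bar>H x\<bar>)" using H by simp
      show "AE x in lborel. (\<lambda>n. H x * ramp n V x) \<longlonglongrightarrow> H x * indicator V x"
        by (intro AE_I2 tendsto_mult tendsto_const ramp_tendsto V)
      show "AE x in lborel. norm (H x * ramp n V x) \<le> \<bar>H x\<bar>" for n
        by (intro AE_I2) (simp add: abs_mult mult_left_le ramp_bounds)
      have [measurable]: "H \<in> borel_measurable borel" "ramp n V \<in> borel_measurable borel"
        "V \<in> sets borel" for n
        using borel_measurable_integrable[OF H] borel_measurable_continuous_onI[OF ramp_continuous] V by simp_all
      show "(\<lambda>x. H x * ramp n V x) \<in> borel_measurable lborel" for n by measurable
      show "(\<lambda>x. H x * indicator V x) \<in> borel_measurable lborel" by measurable
    qed
    then have "(\<integral>x. H x * indicator V x \<partial>lborel) = 0"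
      by (simp add: zero LIMSEQ_const_iff)
    moreover have "H x * indicator V x = indicator U x *\<^sub>R H x" for x
      by (auto simp: H_def V_def indicator_def)
    ultimately show ?thesis by (simp add: set_lebesgue_integral_def)
  qed
  from AE_zero_if_open_integrals_zero[OF H this] show ?thesis
    by (intro exI[of _ m]) (auto simp: H_def B_def elim!: eventually_mono)
qed

text \<open>No measurability is assumed: Lebesgue measure is complete, and nonintegrable functions have integral 0.\<close>

lemma
  fixes f g :: "'a::euclidean_space \<Rightarrow> 'b::euclidean_space"
  assumes S: "S \<in> sets lebesgue" and ae: "AE x in lebesgue_on S. f x = g x"
  shows integrable_lebesgue_on_cong_AE: "integrable (lebesgue_on S) f \<longleftrightarrow> integrable (lebesgue_on S) g"
    and integral_lebesgue_on_cong_AE: "(LINT x|lebesgue_on S. f x) = (LINT x|lebesgue_on S. g x)"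
proof -
  let ?f = "\<lambda>x. indicator S x *\<^sub>R f x" and ?g = "\<lambda>x. indicator S x *\<^sub>R g x"
  have S': "S \<inter> space lebesgue \<in> sets lebesgue" using S by simp
  have ae': "AE x in lebesgue. ?f x = ?g x"
    using ae unfolding AE_restrict_space_iff[OF S'] by eventually_elim (auto simp: indicator_def)
  have ae'': "AE x in lebesgue. ?g x = ?f x"
    using ae' by (rule eventually_mono) (rule sym)
  have meas: "?f \<in> borel_measurable lebesgue \<longleftrightarrow> ?g \<in> borel_measurable lebesgue"
    using borel_measurable_AE[OF _ ae'] borel_measurable_AE[OF _ ae''] by blast
  have "integrable lebesgue ?f \<longleftrightarrow> integrable lebesgue ?g"
  proof (cases "?f \<in> borel_measurable lebesgue")
    case True
    then show ?thesis using integrable_cong_AE[OF True _ ae'] meas by blast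
  next
    case False
    then show ?thesis using meas borel_measurable_integrable by blast
  qed
  then show int: "integrable (lebesgue_on S) f \<longleftrightarrow> integrable (lebesgue_on S) g"
    by (simp add: integrable_restrict_space[OF S'])
  show "(LINT x|lebesgue_on S. f x) = (LINT x|lebesgue_on S. g x)"
  proof (cases "?f \<in> borel_measurable lebesgue")
    case True
    then show ?thesis
      unfolding integral_restrict_space[OF S'] using meas ae' by (intro integral_cong_AE) auto
  next
    case False
    then have "\<not> integrable lebesgue ?f" by auto
    then have "\<not> integrable (lebesgue_on S) f"
      by (simp add: integrable_restrict_space[OF S'])
    then show ?thesis using int by (simp add: not_integrable_integral_eq)
  qed
qed

lemma AE_lebesgue_on_subset:
  assumes "AE x in lebesgue_on S. P x" "T \<subseteq> S" "S \<in> sets lebesgue" "T \<in> sets lebesgue"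
  shows "AE x in lebesgue_on T. P x"
  using assms(1) assms(2-) by (simp add: AE_restrict_space_iff) (auto elim: eventually_mono)

text \<open>The product lives on the compact support of d, where f is integrable and d is bounded;
  its extension by zero is the product on \<open>D\<close>.\<close>

lemma loc_integrable_integrable_mult:
  fixes f d :: "vec3 \<Rightarrow> real"
  assumes D: "open D" and f: "loc_integrable D f" and d: "d \<in> test_functions D"
  shows "integrable (lebesgue_on D) (\<lambda>x. f x * d x)"
proof -
  let ?K = "closure {x. d x \<noteq> 0}"
  have K: "compact ?K" "?K \<subseteq> D" using d by (simp_all add: test_functions_def)
  have Km: "?K \<in> sets lebesgue" and Dm: "D \<in> sets lebesgue" using D by auto
  obtain B where B: "B \<ge> 0" "\<And>x. norm (d x) \<le> B"
    using test_functions_bounded[OF d] by blast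
  have "integrable (lebesgue_on ?K) f"
    using f K by (simp add: loc_integrable_def)
  then have f': "integrable lebesgue (\<lambda>x. indicator ?K x *\<^sub>R f x)"
    using Km by (simp add: integrable_restrict_space)
  have "d \<in> borel_measurable borel"
    by (rule borel_measurable_continuous_onI[OF test_functions_continuous[OF d]])
  then have dm: "d \<in> borel_measurable lebesgue"
    by (simp add: measurable_completion)
  have "integrable lebesgue (\<lambda>x. (indicator ?K x *\<^sub>R f x) * d x)"
  proof (rule Bochner_Integration.integrable_bound)
    show "integrable lebesgue (\<lambda>x. B * (indicator ?K x *\<^sub>R f x))"
      by (rule integrable_mult_right[OF f'])
    show "(\<lambda>x. indicator ?K x *\<^sub>R f x * d x) \<in> borel_measurable lebesgue"
      by (intro borel_measurable_times dm borel_measurable_integrable[OF f'])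
    show "AE x in lebesgue. norm (indicator ?K x *\<^sub>R f x * d x) \<le> norm (B * (indicator ?K x *\<^sub>R f x))"
    proof (rule AE_I2)
      fix x
      show "norm (indicator ?K x *\<^sub>R f x * d x) \<le> norm (B * (indicator ?K x *\<^sub>R f x))"
        using mult_left_mono[OF B(2)[of x], of "\<bar>indicator ?K x * f x\<bar>"] B(1)
        by (simp add: abs_mult mult_ac)
    qed
  qed
  moreover have "(\<lambda>x. (indicator ?K x *\<^sub>R f x) * d x) = (\<lambda>x. indicator D x *\<^sub>R (f x * d x))"
  proof
    fix x
    show "(indicator ?K x *\<^sub>R f x) * d x = indicator D x *\<^sub>R (f x * d x)"
      using closure_subset[of "{x. d x \<noteq> 0}"] K(2) by (cases "d x = 0") (auto simp: indicator_def)
  qed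
  ultimately show ?thesis
    using Dm by (simp add: integrable_restrict_space)
qed

text \<open>Bridges from Lebesgue to Borel measurability. On the compact ball of radius 2 * r the
  function is integrable; cut off there, it agrees almost everywhere with a Borel function, and test
  functions supported in that ball do not notice either change.\<close>

lemma weak_gradient_zero_ball:
  fixes f :: "vec3 \<Rightarrow> real"
  assumes \<phi>: "cutoff \<phi>" and D: "open D" and f: "loc_integrable D f"
    and orth: "\<And>\<psi> j. \<psi> \<in> test_functions D \<Longrightarrow> (LINT x|lebesgue_on D. f x * partial j \<psi> x) = 0"
    and r: "r > 0" "cball x0 (2 * r) \<subseteq> D"
  shows "\<exists>m. AE x in lebesgue. x \<in> ball x0 r \<longrightarrow> f x = m"
proof -
  let ?K = "cball x0 (2 * r)"
  define g where "g x = indicator ?K x *\<^sub>R f x" for x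
  have "integrable (lebesgue_on ?K) f"
    using f r(2) by (simp add: loc_integrable_def)
  then have g: "integrable lebesgue g"
    unfolding g_def[abs_def] by (subst (asm) integrable_restrict_space) auto
  obtain F where F: "F \<in> borel_measurable lborel" "AE x in lborel. g x = F x"
    using completion_ex_borel_measurable_real[OF borel_measurable_integrable[OF g]] by blast
  have Fm: "F \<in> borel_measurable lebesgue" using F(1) by (simp add: measurable_completion)
  have gF: "AE x in lebesgue. g x = F x"
    using F(2) by (rule AE_completion)
  have "integrable lebesgue F"
    using g gF Fm borel_measurable_integrable[OF g] by (subst integrable_cong_AE[symmetric, of g]) auto
  then have Fi: "integrable lborel F"
    using F(1) by (simp add: integrable_completion)
  have "(\<integral>y. F y * partial j \<psi> y \<partial>lborel) = 0" if \<psi>: "\<psi> \<in> test_functions (ball x0 (2 * r))" for \<psi> j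
  proof -
    have p: "partial j \<psi> \<in> test_functions (ball x0 (2 * r))"
      by (rule test_functions_partial[OF \<psi>])
    have pm: "partial j \<psi> \<in> borel_measurable borel"
      by (rule borel_measurable_continuous_onI[OF test_functions_continuous[OF p]])
    then have pm': "partial j \<psi> \<in> borel_measurable lebesgue"
      by (simp add: measurable_completion)
    have sub: "ball x0 (2 * r) \<subseteq> D" using r(2) by auto
    then have \<psi>D: "\<psi> \<in> test_functions D" using \<psi> test_functions_mono by blast
    have "(\<integral>y. F y * partial j \<psi> y \<partial>lborel) = (\<integral>y. F y * partial j \<psi> y \<partial>lebesgue)"
      using F(1) pm by (intro integral_completion[symmetric] borel_measurable_times) auto
    also have "\<dots> = (\<integral>y. g y * partial j \<psi> y \<partial>lebesgue)"
      using gF Fm pm' borel_measurable_integrable[OF g]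
      by (intro integral_cong_AE borel_measurable_times) auto
    also have "\<dots> = (\<integral>y. indicator D y *\<^sub>R (f y * partial j \<psi> y) \<partial>lebesgue)"
    proof (rule Bochner_Integration.integral_cong[OF refl])
      fix y
      show "g y * partial j \<psi> y = indicator D y *\<^sub>R (f y * partial j \<psi> y)"
      proof (cases "partial j \<psi> y = 0")
        case False
        then have "y \<in> ball x0 (2 * r)"
          using p closure_subset[of "{x. partial j \<psi> x \<noteq> 0}"] unfolding test_functions_def by blast
        then show ?thesis using sub by (auto simp: g_def)
      qed simp
    qed
    also have "\<dots> = (LINT y|lebesgue_on D. f y * partial j \<psi> y)"
      using D by (subst integral_restrict_space) auto
    also have "\<dots> = 0" by (rule orth[OF \<psi>D])
    finally show ?thesis .
  qed
  from weak_gradient_zero_ball_lborel[OF \<phi> Fi r(1) this]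
  obtain m where "AE x in lborel. x \<in> ball x0 r \<longrightarrow> F x = m" by blast
  then have "AE x in lebesgue. x \<in> ball x0 r \<longrightarrow> F x = m"
    by (rule AE_completion)
  with gF have "AE x in lebesgue. x \<in> ball x0 r \<longrightarrow> f x = m"
    by eventually_elim (use r(1) in \<open>auto simp: g_def\<close>)
  then show ?thesis by blast
qed

section \<open>From balls to connected domains\<close>

lemma AE_const_unique:
  fixes U :: "'a::euclidean_space set"
  assumes "open U" "U \<noteq> {}" "AE x in lebesgue. x \<in> U \<longrightarrow> f x = m" "AE x in lebesgue. x \<in> U \<longrightarrow> f x = m'"
  shows "m = m'"
proof (rule ccontr)
  assume "m \<noteq> m'"
  then have "AE x in lebesgue. x \<notin> U"
    by (intro eventually_mono[OF eventually_conj[OF assms(3,4)]]) auto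
  moreover have "U \<in> sets lebesgue" using assms(1) by auto
  ultimately have "negligible U"
    using AE_iff_null_sets negligible_iff_null_sets by blast
  then show False using assms(1,2) open_not_negligible by blast
qed

text \<open>Almost-everywhere values cannot be compared pointwise, so connectedness is applied to
  the map \<open>m\<close> sending a point to the constant value of f near it. This map is locally
  constant: if b lies in the ball around a, the balls around a and b overlap in a nonempty open set,
  where both constants are attained.\<close>

lemma weak_gradient_zero_imp_const:
  fixes f :: "vec3 \<Rightarrow> real"
  assumes \<phi>: "cutoff \<phi>" and D: "open D" "connected D" and f: "loc_integrable D f"
    and orth: "\<And>\<psi> j. \<psi> \<in> test_functions D \<Longrightarrow> (LINT x|lebesgue_on D. f x * partial j \<psi> x) = 0"
  shows "\<exists>c. AE x in lebesgue_on D. f x = c"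
proof -
  have "\<exists>m r. r > 0 \<and> (AE y in lebesgue. y \<in> ball x r \<longrightarrow> f y = m)" if x: "x \<in> D" for x
  proof -
    obtain e where e: "e > 0" "cball x e \<subseteq> D" using D(1) x open_contains_cball by blast
    then have "e / 2 > 0" "cball x (2 * (e / 2)) \<subseteq> D" by simp_all
    from weak_gradient_zero_ball[OF \<phi> D(1) f orth this] show ?thesis
      using \<open>e / 2 > 0\<close> by blast
  qed
  then have "\<forall>x\<in>D. \<exists>p. snd p > 0 \<and> (AE y in lebesgue. y \<in> ball x (snd p) \<longrightarrow> f y = fst p)"
    by simp
  from bchoice[OF this] obtain p where p:
    "\<forall>x\<in>D. snd (p x) > 0 \<and> (AE y in lebesgue. y \<in> ball x (snd (p x)) \<longrightarrow> f y = fst (p x))" ..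
  define m r where "m x = fst (p x)" and "r x = snd (p x)" for x
  have r: "r x > 0" and m: "AE y in lebesgue. y \<in> ball x (r x) \<longrightarrow> f y = m x" if "x \<in> D" for x
    using p that by (simp_all add: m_def r_def)
  have m_const: "m a = m b" if "a \<in> D" "b \<in> D" for a b
  proof (rule connected_local_const[OF D(2) that], intro ballI)
    fix a assume a: "a \<in> D"
    have "m a = m b" if b: "b \<in> D" "b \<in> ball a (r a)" for b
    proof (rule AE_const_unique)
      show "open (ball a (r a) \<inter> ball b (r b))" by auto
      show "ball a (r a) \<inter> ball b (r b) \<noteq> {}" using b r[OF b(1)] by (simp add: disjoint_iff exI[of _ b])
      show "AE y in lebesgue. y \<in> ball a (r a) \<inter> ball b (r b) \<longrightarrow> f y = m a"
        using m[OF a] by eventually_elim simp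
      show "AE y in lebesgue. y \<in> ball a (r a) \<inter> ball b (r b) \<longrightarrow> f y = m b"
        using m[OF b(1)] by eventually_elim simp
    qed
    then show "\<forall>\<^sub>F b in at a within D. m a = m b"
      unfolding eventually_at using r[OF a] by (intro exI[of _ "r a"]) (simp add: dist_commute)
  qed
  show ?thesis
  proof (cases "D = {}")
    case True
    then show ?thesis by (simp add: AE_restrict_space_iff)
  next
    case False
    then obtain a where a: "a \<in> D" by blast
    define S where "S = {x \<in> D. f x \<noteq> m a}"
    \<comment> \<open>Each of the balls, one for every point of \<open>D\<close>, has an exceptional
      null set of its own. Being negligible is a local property, which replaces the union of these
      null sets by a check near each point.\<close>
    have "negligible S"
    proof (subst locally_negligible_alt, rule ballI)
      fix x assume x: "x \<in> S"
      then have xD: "x \<in> D" by (simp add: S_def)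
      have "AE y in lebesgue. y \<notin> S \<inter> ball x (r x)"
        by (rule eventually_mono[OF m[OF xD]]) (use m_const[OF xD a] in \<open>auto simp: S_def\<close>)
      then obtain Z where Z: "\<And>y. y \<in> space lebesgue - Z \<Longrightarrow> y \<notin> S \<inter> ball x (r x)" "Z \<in> null_sets lebesgue"
        by (rule AE_E3) (rule that)
      then have "negligible Z"
        by (simp only: negligible_iff_null_sets)
      moreover have "S \<inter> ball x (r x) \<subseteq> Z"
      proof
        fix y assume y: "y \<in> S \<inter> ball x (r x)"
        show "y \<in> Z"
        proof (rule ccontr)
          assume "y \<notin> Z"
          then have "y \<in> space lebesgue - Z" by simp
          from Z(1)[OF this] y show False by (rule notE)
        qed
      qed
      ultimately have "negligible (S \<inter> ball x (r x))"
        by (rule negligible_subset)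
      moreover have "openin (top_of_set S) (S \<inter> ball x (r x))" by (simp add: openin_open_Int)
      ultimately show "\<exists>U. openin (top_of_set S) U \<and> x \<in> U \<and> negligible U"
        using x r[OF xD] by (intro exI[of _ "S \<inter> ball x (r x)"]) simp
    qed
    then have "AE x in lebesgue. x \<notin> S"
      unfolding negligible_iff_null_sets by (rule AE_not_in)
    then have "AE x in lebesgue. x \<in> D \<longrightarrow> f x = m a"
      by (rule eventually_mono) (simp add: S_def)
    then have "AE x in lebesgue_on D. f x = m a"
      using D(1) by (simp add: AE_restrict_space_iff)
    then show ?thesis by blast
  qed
qed

section \<open>The pressure\<close>

lemma weak_partial_cong_AE:
  assumes D: "open D" and ae: "AE x in lebesgue_on D. f x = f' x"
  shows "weak_partial D j f g \<longleftrightarrow> weak_partial D j f' g"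
proof -
  have Dm: "D \<in> sets lebesgue" using D by auto
  have "integrable (lebesgue_on K) f \<longleftrightarrow> integrable (lebesgue_on K) f'" if "compact K" "K \<subseteq> D" for K
  proof -
    have Km: "K \<in> sets lebesgue" using that by (auto simp: compact_imp_closed)
    show ?thesis
      by (rule integrable_lebesgue_on_cong_AE[OF Km AE_lebesgue_on_subset[OF ae that(2) Dm Km]])
  qed
  then have "loc_integrable D f \<longleftrightarrow> loc_integrable D f'"
    unfolding loc_integrable_def by blast
  moreover have "(LINT x|lebesgue_on D. partial j \<psi> x *\<^sub>R f x) = (LINT x|lebesgue_on D. partial j \<psi> x *\<^sub>R f' x)"
    for \<psi> :: scalar_field
    by (rule integral_lebesgue_on_cong_AE[OF Dm]) (use ae in eventually_elim, simp)
  ultimately show ?thesis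
    unfolding weak_partial_def by simp
qed

text \<open>Equality holds at every point: functions equal almost everywhere have the same weak
  derivatives g, so \<open>SOME\<close> selects the same one.\<close>

lemma wgrad_cong_AE:
  assumes "open D" "AE x in lebesgue_on D. u x = v x"
  shows "wgrad D u = wgrad D v"
  by (simp add: wgrad_def wpartial_def fun_eq_iff weak_partial_cong_AE[OF assms])

lemma pairing_cong_AE:
  assumes "open D" "AE x in lebesgue_on D. u x = v x"
  shows "pairing D u \<psi> = pairing D v \<psi>"
  unfolding pairing_def using assms
  by (intro integral_lebesgue_on_cong_AE) (auto elim: eventually_mono)

text \<open>On a set of finite measure this follows from \<bar>y\<bar> \<le> 1 + \<bar>y\<bar> powr
  r. It lets the integral of the difference of two pressures be split.\<close>

lemma Lp_integrable:
  fixes f :: "vec3 \<Rightarrow> real"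
  assumes f: "f \<in> Lp r \<Omega>" and r: "r > 1" and \<Omega>: "\<Omega> \<in> lmeasurable"
  shows "integrable (lebesgue_on \<Omega>) f"
proof (rule Bochner_Integration.integrable_bound)
  interpret finite_measure "lebesgue_on \<Omega>"
    using \<Omega> by (rule finite_measure_lebesgue_on)
  show "integrable (lebesgue_on \<Omega>) (\<lambda>x. 1 + norm (f x) powr r)"
    using f by (auto simp: Lp_def)
  show "f \<in> borel_measurable (lebesgue_on \<Omega>)"
    using f by (simp add: Lp_def)
  have "\<bar>y\<bar> \<le> 1 + \<bar>y\<bar> powr r" for y :: real
  proof (cases "\<bar>y\<bar> \<le> 1")
    case False
    then have "\<bar>y\<bar> powr 1 \<le> \<bar>y\<bar> powr r" using r by (intro powr_mono) auto
    then show ?thesis using False by simp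
  qed (simp add: add_increasing2)
  then show "AE x in lebesgue_on \<Omega>. norm (f x) \<le> norm (1 + norm (f x) powr r)"
    by (intro AE_I2) (simp add: add_nonneg_nonneg)
qed

text \<open>The momentum equation tests the pressure with divergences of vector fields; a scalar
  test function times a basis vector isolates a single partial derivative.\<close>

lemma test_functions_scaleR_axis:
  assumes s: "s \<in> test_functions D"
  shows "(\<lambda>x. s x *\<^sub>R axis j (1::real)) \<in> test_functions D"
    and "divg (\<lambda>x. s x *\<^sub>R axis j 1) = partial j s"
proof -
  have "{x. s x *\<^sub>R axis j (1::real) \<noteq> 0} = {x. s x \<noteq> 0}"
    by (simp add: axis_eq_0_iff)
  then show "(\<lambda>x. s x *\<^sub>R axis j (1::real)) \<in> test_functions D"
    using s by (simp add: test_functions_def Ck_scaleR_const)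
  show "divg (\<lambda>x. s x *\<^sub>R axis j 1) = partial j s"
  proof
    fix x
    have "partial k (\<lambda>x. s x *\<^sub>R axis j (1::real)) x $ k = (if k = j then partial j s x else 0)" for k
      using partial_scaleR_const(1)[OF test_functions_differentiable[OF s], of k "axis j (1::real)" x]
      by (simp add: axis_def)
    then show "divg (\<lambda>x. s x *\<^sub>R axis j 1) x = partial j s x"
      by (simp add: divg_def)
  qed
qed

text \<open>Subtracting the momentum equations at the two times cancels all terms but the pressure.
  For the time derivative this works because pairings ignore null sets: the function of time being
  differentiated is itself periodic.\<close>

lemma pressure_weak_gradient_shift:
  assumes D: "open D" and mom: "momentum_equation D \<phi> \<eta> \<omega> u p"
    and per: "\<And>t. \<eta> (t + l) = \<eta> t" "\<And>t. \<omega> (t + l) = \<omega> t"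
    and u: "\<And>t. AE x in lebesgue_on D. u (t + l) x = u t x"
    and \<psi>: "\<psi> \<in> test_functions D"
  shows "pairing D (p (t + l)) (divg \<psi>) = pairing D (p t) (divg \<psi>)"
proof -
  note cong = pairing_cong_AE[OF D]
  have "deriv (\<lambda>\<tau>. pairing D (u \<tau>) \<psi>) (t + l) = deriv (\<lambda>\<tau>. pairing D (u \<tau>) \<psi>) t"
    using deriv_shift[of "\<lambda>\<tau>. pairing D (u \<tau>) \<psi>" l t] cong[OF u] by simp
  moreover have "pairing D (\<lambda>x. wgrad D (u (t + l)) x + u (t + l) x \<otimes>\<^sub>t (\<eta> (t + l) + cross3 (\<omega> (t + l)) x)) (grad \<psi>)
      = pairing D (\<lambda>x. wgrad D (u t) x + u t x \<otimes>\<^sub>t (\<eta> t + cross3 (\<omega> t) x)) (grad \<psi>)"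
    by (rule cong) (use u[of t] in eventually_elim, simp add: per wgrad_cong_AE[OF D u[of t]])
  moreover have "pairing D (\<lambda>x. cross3 (\<omega> (t + l)) (u (t + l) x)) \<psi> = pairing D (\<lambda>x. cross3 (\<omega> t) (u t x)) \<psi>"
    by (rule cong) (use u[of t] in eventually_elim, simp add: per)
  moreover have "pairing D (conv_tensor \<phi> \<eta> \<omega> u (t + l)) (grad \<psi>) = pairing D (conv_tensor \<phi> \<eta> \<omega> u t) (grad \<psi>)"
    by (rule cong)
      (use u[of t] in eventually_elim, simp add: conv_tensor_def Let_def lift_shift[of \<eta> l \<omega>, OF per])
  moreover have "force \<phi> \<eta> \<omega> (t + l) = force \<phi> \<eta> \<omega> t"
    by (rule force_shift[of \<eta> l \<omega>, OF per])
  ultimately show ?thesis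
    using mom[unfolded momentum_equation_def, rule_format, OF \<psi>, of "t + l"]
      mom[unfolded momentum_equation_def, rule_format, OF \<psi>, of t] by simp
qed

lemma trunc_measure_pos:
  assumes D: "exterior_domain D" and R: "R > 2"
  shows "trunc D R \<in> lmeasurable" "measure lebesgue (trunc D R) > 0"
proof -
  have op: "open (trunc D R)" using D by (auto simp: exterior_domain_def trunc_def)
  have bd: "bounded (trunc D R)" by (auto simp: trunc_def intro: bounded_subset[of "ball 0 R"])
  show m: "trunc D R \<in> lmeasurable" using bd op by (intro bounded_set_imp_lmeasurable) auto
  \<comment> \<open>Its norm 3/2 lies between 1 and R, so the point avoids the obstacle inside the
    unit ball and witnesses that the truncated domain is a nonempty open set.\<close>
  let ?x = "(3 / 2) *\<^sub>R axis 1 1 :: vec3"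
  have "?x \<notin> ball 0 1" "?x \<in> ball 0 R" using R by simp_all
  then have "?x \<in> trunc D R" using D by (auto simp: trunc_def exterior_domain_def)
  then have "\<not> negligible (trunc D R)" using op open_not_negligible by blast
  then show "measure lebesgue (trunc D R) > 0"
    using m by (simp add: negligible_iff_measure zero_less_measure_iff measure_nonneg order_less_le)
qed

lemma associated_pressure_periodic:
  assumes D: "exterior_domain D" and \<phi>: "cutoff \<phi>" and R: "R > 2" and r: "r > 1"
    and p: "associated_pressure D \<phi> \<eta> \<omega> u R r p"
    and per: "\<And>t. \<eta> (t + l) = \<eta> t" "\<And>t. \<omega> (t + l) = \<omega> t"
    and u: "\<And>t. AE x in lebesgue_on D. u (t + l) x = u t x"
  shows "AE x in lebesgue_on D. p (t + l) x = p t x"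
proof -
  have oD: "open D" "connected D" using D by (auto simp: exterior_domain_def)
  then have Dm: "D \<in> sets lebesgue" by auto
  have loc: "loc_integrable D (p t)" for t
    using p by (simp add: associated_pressure_def)
  have mom: "momentum_equation D \<phi> \<eta> \<omega> u p"
    using p by (simp add: associated_pressure_def)
  define f where "f x = p (t + l) x - p t x" for x
  have floc: "loc_integrable D f"
    using loc[of t] loc[of "t + l"] unfolding loc_integrable_def f_def[abs_def] by auto
  have "(LINT x|lebesgue_on D. f x * partial j s x) = 0" if s: "s \<in> test_functions D" for s j
  proof -
    have "pairing D (p (t + l)) (partial j s) = pairing D (p t) (partial j s)"
      using pressure_weak_gradient_shift[OF oD(1) mom per u test_functions_scaleR_axis(1)[OF s], of t j]
      by (simp only: test_functions_scaleR_axis(2)[OF s])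
    moreover have "integrable (lebesgue_on D) (\<lambda>x. p t x * partial j s x)" for t
      by (rule loc_integrable_integrable_mult[OF oD(1) loc test_functions_partial[OF s]])
    ultimately show ?thesis
      by (simp add: f_def pairing_def left_diff_distrib)
  qed
  from weak_gradient_zero_imp_const[OF \<phi> oD floc this]
  obtain c where c: "AE x in lebesgue_on D. f x = c" by blast
  let ?T = "trunc D R"
  have T: "?T \<in> lmeasurable" "measure lebesgue ?T > 0"
    using trunc_measure_pos[OF D R] by auto
  have Tm: "?T \<in> sets lebesgue" using T(1) by (rule fmeasurableD)
  have int: "integrable (lebesgue_on ?T) (p t)" for t
    using p by (intro Lp_integrable[OF _ r T(1)]) (auto simp: associated_pressure_def BC_weak_def)
  \<comment> \<open>Both pressures have mean zero over the truncated domain, so c times its positive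
    measure vanishes.\<close>
  have "0 = (LINT x|lebesgue_on ?T. f x)"
    using p int by (simp add: f_def associated_pressure_def)
  also have "\<dots> = (LINT x|lebesgue_on ?T. c)"
    by (rule integral_lebesgue_on_cong_AE[OF Tm AE_lebesgue_on_subset[OF c _ Dm Tm]]) (auto simp: trunc_def)
  also have "\<dots> = measure lebesgue ?T * c"
    using Tm by (simp add: measure_restrict_space)
  finally have "c = 0" using T(2) by simp
  with c show ?thesis by (auto simp: f_def elim: eventually_mono)
qed

theorem corollary2p1:
  fixes D :: "vec3 set" and \<phi> :: scalar_field and \<delta> C l :: real
    and \<eta> \<omega> :: "real \<Rightarrow> vec3" and u :: "real \<Rightarrow> vector_field"
  assumes "exterior_domain D" and "cutoff \<phi>"
    and "smallness_constants D \<phi> \<delta> C"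
    and "\<eta> \<in> W1inf_C1" and "\<omega> \<in> W1inf_C1"
    and "W1inf_norm (\<lambda>t. (\<eta> t, \<omega> t)) \<le> \<delta>"
    and "is_solution D \<phi> C \<eta> \<omega> u"
    and "l > 0"
    and "\<And>t. \<eta> (t + l) = \<eta> t" and "\<And>t. \<omega> (t + l) = \<omega> t"
  shows "(\<forall>t. AE x in lebesgue_on D. u (t + l) x = u t x) \<and>
    (\<forall>R>2. \<forall>r>1. \<forall>p. associated_pressure D \<phi> \<eta> \<omega> u R r p \<longrightarrow>
       (\<forall>t. AE x in lebesgue_on D. p (t + l) x = p t x))"
proof -
  note per = \<open>\<And>t. \<eta> (t + l) = \<eta> t\<close> \<open>\<And>t. \<omega> (t + l) = \<omega> t\<close>
  \<comment> \<open>Uniqueness is stated relative to one reference solution, so u and its translate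
    are each compared with it and then with each other.\<close>
  obtain w where w: "\<And>v t. is_solution D \<phi> C \<eta> \<omega> v \<Longrightarrow> AE x in lebesgue_on D. v t x = w t x"
    using assms(3-6) unfolding smallness_constants_def by blast
  have u: "AE x in lebesgue_on D. u (t + l) x = u t x" for t
    using w[OF is_solution_shift[OF assms(7) per], of t] w[OF assms(7), of t] by eventually_elim simp
  have "AE x in lebesgue_on D. p (t + l) x = p t x"
    if "R > 2" "r > 1" "associated_pressure D \<phi> \<eta> \<omega> u R r p" for R r p t
    by (rule associated_pressure_periodic[where l = l and \<eta> = \<eta> and \<omega> = \<omega> and u = u,
          OF assms(1,2) that per u])
  with u show ?thesis by blast
qed

end
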